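(* Let $n\ge3$. In $L^2(\mathbb{R}^n)$ let $$A=\frac{1}{2i}\Bigl(\frac{x}{|x|}\cdot\nabla+\nabla\cdot\frac{x}{|x|}\Bigr)=-i\frac{x}{|x|}\cdot\nabla-i\frac{n-1}{2|x|},\qquad D(A)=\Bigl\{\varphi\in L^2(\mathbb{R}^n):\tfrac{x}{|x|}\cdot\nabla\varphi,\ \tfrac{1}{|x|}\varphi\in L^2(\mathbb{R}^n)\Bigr\},$$ and let $B$ be multiplication by $\frac{1}{|x|}$ with $D(B)=\{\varphi\in L^2(\mathbb{R}^n):\tfrac{1}{|x|}\varphi\in L^2(\mathbb{R}^n)\}$. Let $\varphi\in H^1(\mathbb{R}^n)$ satisfy $A\varphi\neq0$ and $B\varphi\neq0$. Then $$\begin{aligned}\|B\varphi\|^2&=-i([A,B]\varphi|\varphi)\\&=-2\operatorname{Im}(A\varphi|B\varphi)\\&=\|A\varphi\|\|B\varphi\|\left(2-\left\|\frac{A\varphi}{\|A\varphi\|}+i\frac{B\varphi}{\|B\varphi\|}\right\|^2\right),\end{aligned}$$ and $$\|A\varphi\|^2=\|\partial_r\varphi\|^2-\frac{(n-1)(n-3)}{4}\|B\varphi\|^2.$$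
   Context: $L^2(\mathbb{R}^n)$ is the space of complex-valued square integrable functions with scalar product $(\varphi|\psi)=\int_{\mathbb{R}^n}\varphi\overline{\psi}\,dx$ (linear in the first variable, antilinear in the second) and norm $\|\cdot\|$. $H^1(\mathbb{R}^n)=\{\varphi\in L^2(\mathbb{R}^n):\partial_j\varphi\in L^2(\mathbb{R}^n)\text{ for all }1\le j\le n\}$ with distributional derivatives. $|x|$ is the Euclidean length and $\partial_r=\frac{x}{|x|}\cdot\nabla=\sum_{j=1}^n\frac{x_j}{|x|}\partial_j$ is the radial derivative. The commutator is understood as a sesquilinear form on $D(A)\cap D(B)$: $([A,B]\varphi|\psi)=(B\varphi|A\psi)-(A\varphi|B\psi)$ for $\varphi,\psi\in D(A)\cap D(B)$. *)

theory Defs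
  imports "HOL-Analysis.Analysis"
begin

text \<open>
  Elements of \<open>L\<^sup>2\<close> are represented by Lebesgue measurable functions; equality of elements
  is equality almost everywhere.
\<close>

definition L2 :: "(real^'n \<Rightarrow> complex) set" where
  "L2 = {f. f \<in> borel_measurable lebesgue \<and> integrable lebesgue (\<lambda>x. (cmod (f x))\<^sup>2)}"

definition ip :: "(real^'n \<Rightarrow> complex) \<Rightarrow> (real^'n \<Rightarrow> complex) \<Rightarrow> complex" where
  "ip f g = (LINT x|lebesgue. f x * cnj (g x))"

definition L2_nrm :: "(real^'n \<Rightarrow> complex) \<Rightarrow> real" where
  "L2_nrm f = sqrt (LINT x|lebesgue. (cmod (f x))\<^sup>2)"

definition partial :: "'n \<Rightarrow> (real^'n \<Rightarrow> complex) \<Rightarrow> real^'n \<Rightarrow> complex" where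
  "partial j f x = frechet_derivative f (at x) (axis j 1)"

primrec Ck :: "nat \<Rightarrow> (real^'n \<Rightarrow> complex) \<Rightarrow> bool" where
  "Ck 0 f \<longleftrightarrow> continuous_on UNIV f"
| "Ck (Suc k) f \<longleftrightarrow> f differentiable_on UNIV \<and> (\<forall>j. Ck k (partial j f))"

definition test_functions :: "(real^'n) set \<Rightarrow> (real^'n \<Rightarrow> complex) set" where
  "test_functions \<Omega> =
     {\<psi>. (\<forall>k. Ck k \<psi>) \<and> compact (closure {x. \<psi> x \<noteq> 0}) \<and> closure {x. \<psi> x \<noteq> 0} \<subseteq> \<Omega>}"

text \<open>
  A distribution on an open set \<open>\<Omega>\<close> is given by its values on \<open>test_functions \<Omega>\<close>;
  its values on other functions are irrelevant. The pairing is bilinear.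
\<close>

type_synonym 'n distribution = "(real^'n \<Rightarrow> complex) \<Rightarrow> complex"

definition dist_of :: "(real^'n \<Rightarrow> complex) \<Rightarrow> 'n distribution" where
  "dist_of f \<psi> = (LINT x|lebesgue. f x * \<psi> x)"

definition dist_deriv :: "'n::finite \<Rightarrow> 'n distribution \<Rightarrow> 'n distribution" where
  "dist_deriv j T \<psi> = - T (partial j \<psi>)"

text \<open>The multiplier has to be smooth on the open set under consideration.\<close>

definition dist_mult :: "(real^'n \<Rightarrow> complex) \<Rightarrow> 'n distribution \<Rightarrow> 'n distribution" where
  "dist_mult a T \<psi> = T (\<lambda>x. a x * \<psi> x)"

definition L2_represents :: "(real^'n) set \<Rightarrow> 'n distribution \<Rightarrow> (real^'n \<Rightarrow> complex) \<Rightarrow> bool" where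
  "L2_represents \<Omega> T g \<longleftrightarrow> g \<in> L2 \<and> (\<forall>\<psi>\<in>test_functions \<Omega>. T \<psi> = dist_of g \<psi>)"

text \<open>
  If \<open>\<Omega>\<close> is open with a complement of measure zero, a representing function is unique up to
  null sets; \<open>L2_rep\<close> picks one.
\<close>

definition L2_rep :: "(real^'n) set \<Rightarrow> 'n distribution \<Rightarrow> real^'n \<Rightarrow> complex" where
  "L2_rep \<Omega> T = (SOME g. L2_represents \<Omega> T g)"

definition weak_deriv :: "'n \<Rightarrow> (real^'n \<Rightarrow> complex) \<Rightarrow> real^'n \<Rightarrow> complex" where
  "weak_deriv j f = L2_rep UNIV (dist_deriv j (dist_of f))"

definition H1 :: "(real^'n \<Rightarrow> complex) set" where
  "H1 = {f \<in> L2. \<forall>j. \<exists>g. L2_represents UNIV (dist_deriv j (dist_of f)) g}"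

definition unit_radial :: "'n \<Rightarrow> real^'n \<Rightarrow> complex" where
  "unit_radial j x = complex_of_real (x $ j / norm x)"

definition inv_norm :: "real^'n \<Rightarrow> complex" where
  "inv_norm x = complex_of_real (1 / norm x)"

definition radial_deriv_H1 :: "(real^'n \<Rightarrow> complex) \<Rightarrow> real^'n \<Rightarrow> complex" where
  "radial_deriv_H1 f x = (\<Sum>j\<in>UNIV. unit_radial j x * weak_deriv j f x)"

text \<open>
  The coefficients \<open>x\<^sub>j / |x|\<close> are smooth away from the origin only, so for general
  \<open>f \<in> L\<^sup>2\<close> the distributions \<open>(x / |x|) \<cdot> \<nabla> f\<close> and \<open>\<nabla> \<cdot> ((x / |x|) f)\<close> are taken on the
  punctured space.
\<close>

definition punctured :: "(real^'n) set" where
  "punctured = - {0}"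

definition radial_grad :: "(real^'n \<Rightarrow> complex) \<Rightarrow> 'n distribution" where
  "radial_grad f \<psi> = (\<Sum>j\<in>UNIV. dist_mult (unit_radial j) (dist_deriv j (dist_of f)) \<psi>)"

definition radial_div :: "(real^'n \<Rightarrow> complex) \<Rightarrow> 'n distribution" where
  "radial_div f \<psi> = (\<Sum>j\<in>UNIV. dist_deriv j (dist_of (\<lambda>x. unit_radial j x * f x)) \<psi>)"

definition dom_A :: "(real^'n \<Rightarrow> complex) set" where
  "dom_A = {f \<in> L2. (\<exists>g. L2_represents punctured (radial_grad f) g) \<and>
                    (\<lambda>x. inv_norm x * f x) \<in> L2}"

definition op_A :: "(real^'n \<Rightarrow> complex) \<Rightarrow> real^'n \<Rightarrow> complex" where
  "op_A f = L2_rep punctured (\<lambda>\<psi>. 1 / (2 * \<i>) * (radial_grad f \<psi> + radial_div f \<psi>))"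

definition dom_B :: "(real^'n \<Rightarrow> complex) set" where
  "dom_B = {f \<in> L2. (\<lambda>x. inv_norm x * f x) \<in> L2}"

definition op_B :: "(real^'n \<Rightarrow> complex) \<Rightarrow> real^'n \<Rightarrow> complex" where
  "op_B f x = inv_norm x * f x"

text \<open>The commutator form of \<open>S\<close> and \<open>T\<close>, meaningful on the intersection of their domains.\<close>

definition commutator_form ::
  "((real^'n \<Rightarrow> complex) \<Rightarrow> real^'n \<Rightarrow> complex) \<Rightarrow> ((real^'n \<Rightarrow> complex) \<Rightarrow> real^'n \<Rightarrow> complex) \<Rightarrow>
   (real^'n \<Rightarrow> complex) \<Rightarrow> (real^'n \<Rightarrow> complex) \<Rightarrow> complex" where
  "commutator_form S T f g = ip (T f) (S g) - ip (S f) (T g)"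

end

theory Submission
  imports Defs
begin

text \<open>
  Off the origin \<open>div (x / \<bar>x\<bar>) = (n - 1) / \<bar>x\<bar>\<close>, so \<open>A = - i (\<partial>\<^sub>r + (n - 1) / (2 \<bar>x\<bar>))\<close>, and with
  \<open>b = \<parallel>B \<phi>\<parallel>\<^sup>2\<close> everything reduces to \<open>2 Re (\<partial>\<^sub>r \<phi> | B \<phi>) = - (n - 2) b\<close>, the integrated form of
  \<open>\<partial>\<^sub>r \<bar>\<phi>\<bar>\<^sup>2 / \<bar>x\<bar>\<close>, once \<open>b\<close> is known to be finite. Both come from
  \<open>\<integral> \<bar>\<phi>\<bar>\<^sup>2 div V = - 2 Re \<integral> V \<cdot> \<nabla>\<phi> cnj \<phi>\<close> with \<open>V = x / (\<bar>x\<bar>\<^sup>2 + \<epsilon>)\<close>: since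
  \<open>div V \<ge> (n - 2) / (\<bar>x\<bar>\<^sup>2 + \<epsilon>)\<close>, it bounds \<open>b\<close> uniformly in \<open>\<epsilon>\<close>, and then \<open>\<epsilon> \<rightarrow> 0\<close> gives the
  identity. For \<open>\<phi>\<close> in \<open>H\<^sup>1\<close> the integration by parts needs no density argument: testing shows
  \<open>\<phi> (x + h e) - \<phi> x = \<integral>\<^sub>0\<^sup>h (D \<phi>) (x + t e) dt\<close> almost everywhere, hence the translation estimate
  \<open>\<parallel>\<phi> (\<cdot> + h e) - \<phi>\<parallel> \<le> h \<parallel>D \<phi>\<parallel>\<close>, and the product rule is the limit of difference quotients.
\<close>

subsection \<open>Test functions\<close>

text \<open>Two obstacles shape the development. \<open>op_A\<close> is a chosen representative of a
  distribution on the punctured space, so everything said about it holds almost everywhere and goes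
  through the fundamental lemma of the calculus of variations on an open set with null complement.
  And \<open>test_functions\<close> asks for all iterated classical derivatives, so the smoothness
  of bumps and of products with \<open>x $ j / norm x\<close> has to be derived from sets closed
  under differentiation.

  The analysis works without smooth approximation because the translation estimate is linear in the
  step: the quadratic remainder in the difference of |\<phi>|^2 is of order h^2 and disappears after
  division by h. The dimension enters through n - 2 \<ge> 1: half of the regularized Hardy integral
  can then be absorbed into the left side, which leaves a bound free of \<epsilon>.\<close>

lemma partial_eqI: "(f has_derivative f') (at x) \<Longrightarrow> partial j f x = f' (axis j 1)"
  by (simp add: partial_def frechet_derivative_at[symmetric])

text \<open>A coinduction principle for smoothness. The induction on the order keeps
  \<open>f\<close> arbitrary, because lowering the order by one replaces the function by one of its
  partial derivatives, which is again in \<open>S\<close>.\<close>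

lemma Ck_coinduct:
  assumes "f \<in> S"
    and diff: "\<And>f. f \<in> S \<Longrightarrow> f differentiable_on UNIV"
    and part: "\<And>f j. f \<in> S \<Longrightarrow> partial j f \<in> S"
  shows "Ck k f"
  using assms(1)
proof (induction k arbitrary: f)
  case 0
  then show ?case using diff by (auto intro: differentiable_imp_continuous_on)
next
  case (Suc k)
  then show ?case using diff part by auto
qed

lemma smooth_differentiable: "(\<And>k. Ck k f) \<Longrightarrow> f differentiable_on UNIV"
  by (metis Ck.simps(2))

lemma smooth_has_derivative:
  assumes "\<And>k. Ck k f"
  shows "(f has_derivative frechet_derivative f (at x)) (at x)"
  using smooth_differentiable[OF assms] frechet_derivative_works
  by (auto simp: differentiable_on_def)

lemma smooth_partial: "(\<And>k. Ck k f) \<Longrightarrow> Ck k (partial j f)"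
  by (metis Ck.simps(2))

lemma partial_eq_0_if_locally_0:
  assumes "eventually (\<lambda>y. f y = 0) (nhds x)"
  shows "(f has_derivative (\<lambda>_. 0)) (at x)" and "partial j f x = 0"
proof -
  show *: "(f has_derivative (\<lambda>_. 0)) (at x)"
  proof (rule has_derivative_transform_eventually[OF has_derivative_const[of 0]])
    show "\<forall>\<^sub>F y in at x. 0 = f y" using eventually_nhds_x_imp_x assms
      by (auto simp: eventually_at_filter elim: eventually_mono)
    show "0 = f x" using eventually_nhds_x_imp_x[OF assms] by simp
  qed auto
  show "partial j f x = 0" by (simp add: partial_eqI[OF *])
qed

text \<open>A derivative depends only on values nearby, and the complement of the support is an open
  set on which \<open>f\<close> vanishes.\<close>

lemma closure_nonzero_partial:
  "closure {x. partial j f x \<noteq> 0} \<subseteq> closure {x. f x \<noteq> 0}"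
proof -
  have "partial j f x = 0" if "x \<notin> closure {x. f x \<noteq> 0}" for x
  proof (rule partial_eq_0_if_locally_0)
    have "f y = 0" if "y \<in> - closure {x. f x \<noteq> 0}" for y
      using that closure_subset[of "{x. f x \<noteq> 0}"] by blast
    moreover have "open (- closure {x. f x \<noteq> 0})" by (simp add: open_Compl)
    ultimately show "eventually (\<lambda>y. f y = 0) (nhds x)"
      using that unfolding eventually_nhds by (metis ComplI)
  qed
  then show ?thesis by (metis (mono_tags, lifting) closed_closure closure_minimal mem_Collect_eq subsetI)
qed

lemma test_functions_partial:
  assumes "\<psi> \<in> test_functions \<Omega>"
  shows "partial j \<psi> \<in> test_functions \<Omega>"
proof -
  have c: "closure {x. partial j \<psi> x \<noteq> 0} \<subseteq> closure {x. \<psi> x \<noteq> 0}"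
    by (rule closure_nonzero_partial)
  moreover have "Ck k (partial j \<psi>)" for k
    using assms by (auto simp: test_functions_def intro: smooth_partial)
  moreover have "compact (closure {x. partial j \<psi> x \<noteq> 0})"
    using assms c closed_Int_compact[of "closure {x. partial j \<psi> x \<noteq> 0}" "closure {x. \<psi> x \<noteq> 0}"]
    by (simp add: test_functions_def Int_absorb2)
  moreover have "closure {x. \<psi> x \<noteq> 0} \<subseteq> \<Omega>"
    using assms by (simp add: test_functions_def)
  ultimately show ?thesis unfolding test_functions_def by blast
qed

lemma partial_translate:
  assumes "f differentiable at (x + c)"
  shows "((\<lambda>x. f (x + c)) has_derivative frechet_derivative f (at (x + c))) (at x)"
    and "partial j (\<lambda>x. f (x + c)) x = partial j f (x + c)"
proof -
  have "(f has_derivative frechet_derivative f (at (x + c))) (at (x + c))"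
    using assms frechet_derivative_works by blast
  moreover have "((\<lambda>x. x + c) has_derivative (\<lambda>h. h)) (at x)"
    by (auto intro!: derivative_eq_intros)
  ultimately show *: "((\<lambda>x. f (x + c)) has_derivative frechet_derivative f (at (x + c))) (at x)"
    by (rule has_derivative_compose[where g = f and f = "\<lambda>x. x + c", rotated])
  show "partial j (\<lambda>x. f (x + c)) x = partial j f (x + c)"
    using partial_eqI[OF *] by (simp add: partial_def)
qed

lemma smooth_translate:
  assumes "\<And>k. Ck k f"
  shows "Ck k (\<lambda>x. f (x + c))"
proof (rule Ck_coinduct[where S = "{\<lambda>x. g (x + c) | g. \<forall>k. Ck k g}"])
  show "(\<lambda>x. f (x + c)) \<in> {\<lambda>x. g (x + c) | g. \<forall>k. Ck k g}" using assms by auto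
next
  fix h assume "h \<in> {\<lambda>x. g (x + c) | g. \<forall>k. Ck k g}"
  then obtain g where g: "h = (\<lambda>x. g (x + c))" "\<And>k. Ck k g" by auto
  have d: "g differentiable at y" for y
    using smooth_differentiable[OF g(2)] by (simp add: differentiable_on_def)
  show "h differentiable_on UNIV"
    unfolding g(1) differentiable_on_def differentiable_def using partial_translate(1)[OF d] by blast
  fix j
  have "partial j h = (\<lambda>x. partial j g (x + c))"
    unfolding g(1) using partial_translate(2)[OF d] by blast
  then show "partial j h \<in> {\<lambda>x. g (x + c) | g. \<forall>k. Ck k g}" using smooth_partial[OF g(2)] by auto
qed

lemma test_functions_translate:
  fixes \<psi> :: "real^'n \<Rightarrow> complex"
  assumes "\<psi> \<in> test_functions UNIV"
  shows "(\<lambda>x. \<psi> (x + c)) \<in> test_functions UNIV"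
proof -
  have "{x. \<psi> (x + c) \<noteq> 0} = (\<lambda>x. - c + x) ` {x. \<psi> x \<noteq> 0}"
    by (auto simp: image_iff algebra_simps)
  then have "closure {x. \<psi> (x + c) \<noteq> 0} = (\<lambda>x. - c + x) ` closure {x. \<psi> x \<noteq> 0}"
    by (simp only: closure_translation)
  moreover have "compact ((\<lambda>x. - c + x) ` closure {x. \<psi> x \<noteq> 0})"
    using assms by (intro compact_translation) (simp add: test_functions_def)
  moreover have "Ck k (\<lambda>x. \<psi> (x + c))" for k
    using assms by (intro smooth_translate) (simp add: test_functions_def)
  ultimately show ?thesis unfolding test_functions_def by (simp del: compact_closure)
qed

section \<open>Smooth bumps that approximate indicators of boxes\<close>

definition flat :: "real poly \<Rightarrow> real \<Rightarrow> real" where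
  "flat P t = (if t > 0 then poly P (1 / t) * exp (- 1 / t) else 0)"

lemma poly_exp_tendsto_0: "((\<lambda>u. poly P u * exp (- u)) \<longlongrightarrow> (0::real)) at_top"
proof -
  have "((\<lambda>u. \<Sum>i\<le>degree P. coeff P i * (u ^ i / exp u)) \<longlongrightarrow> (\<Sum>i\<le>degree P. coeff P i * 0)) at_top"
    by (intro tendsto_sum tendsto_mult tendsto_const tendsto_power_div_exp_0)
  then show ?thesis
    by (simp add: poly_altdef sum_distrib_right exp_minus divide_inverse mult.assoc)
qed

lemma flat_tendsto_0: "((\<lambda>t. poly P (1 / t) * exp (- 1 / t)) \<longlongrightarrow> (0::real)) (at_right 0)"
  using filterlim_compose[OF poly_exp_tendsto_0 filterlim_inverse_at_top_right, of P]
  by (simp add: inverse_eq_divide)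

text \<open>With u = 1/t one has du/dt = - u^2, so P(u) exp(- u) has the t-derivative u^2 (P(u) -
  P'(u)) exp(- u). This stability under differentiation is why the definition carries a polynomial
  along with the classical exp(- 1/t).\<close>

lemma flat_has_derivative:
  "(flat P has_real_derivative flat ([:0, 0, 1:] * (P - pderiv P)) t) (at t)"
proof (cases t "0::real" rule: linorder_cases)
  case less
  have "((\<lambda>_. 0) has_real_derivative 0) (at t)" by simp
  then have "(flat P has_real_derivative 0) (at t)"
    by (rule has_field_derivative_transform_within_open[where S = "{..<0}"])
      (use less in \<open>auto simp: flat_def\<close>)
  then show ?thesis using less by (simp add: flat_def)
next
  case greater
  have "((\<lambda>t. poly P (1 / t) * exp (- 1 / t)) has_real_derivative
      poly (pderiv P) (1 / t) * (- 1 / t^2) * exp (- 1 / t) + poly P (1 / t) * (exp (- 1 / t) * (1 / t^2))) (at t)"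
    using greater
    by (auto intro!: derivative_eq_intros DERIV_chain'[where g = "poly P"] poly_DERIV
        simp: power2_eq_square field_simps)
  then have "(flat P has_real_derivative
      poly (pderiv P) (1 / t) * (- 1 / t^2) * exp (- 1 / t) + poly P (1 / t) * (exp (- 1 / t) * (1 / t^2))) (at t)"
    by (rule has_field_derivative_transform_within_open[where S = "{0<..}"])
      (use greater in \<open>auto simp: flat_def\<close>)
  then show ?thesis using greater
    by (simp add: flat_def power2_eq_square algebra_simps)
next
  case equal
  \<comment> \<open>Dividing by \<open>t\<close> multiplies the polynomial by its variable, so the
    difference quotient at the origin is again of the form covered by
    \<open>flat_tendsto_0\<close>.\<close>
  have "((\<lambda>t. flat P t / t) \<longlongrightarrow> 0) (at_right 0)"
    by (rule Lim_transform_eventually[OF flat_tendsto_0[of "[:0, 1:] * P"]])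
      (auto simp: eventually_at_filter flat_def)
  moreover have "((\<lambda>t. flat P t / t) \<longlongrightarrow> 0) (at_left 0)"
    by (rule Lim_transform_eventually[OF tendsto_const]) (auto simp: eventually_at_filter flat_def)
  ultimately have "((\<lambda>t. flat P t / t) \<longlongrightarrow> 0) (at 0)"
    using filterlim_split_at_real by blast
  then show ?thesis using equal by (simp add: has_field_derivative_iff flat_def)
qed

text \<open>
  \<open>bump_algebra\<close> and \<open>punctured_module\<close> below are closed under partial derivatives, so that
  \<open>Ck_coinduct\<close> yields the smoothness of their elements.
\<close>

inductive_set bump_algebra :: "(real^'n \<Rightarrow> complex) set" where
  one: "(\<lambda>x. 1) \<in> bump_algebra"
| zero: "(\<lambda>x. 0) \<in> bump_algebra"
| flat: "(\<lambda>x. complex_of_real (flat P (s * (x $ i - a)))) \<in> bump_algebra"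
| add: "f \<in> bump_algebra \<Longrightarrow> g \<in> bump_algebra \<Longrightarrow> (\<lambda>x. f x + g x) \<in> bump_algebra"
| mult: "f \<in> bump_algebra \<Longrightarrow> g \<in> bump_algebra \<Longrightarrow> (\<lambda>x. f x * g x) \<in> bump_algebra"

lemma bump_algebra_derivative:
  fixes f :: "real^'n \<Rightarrow> complex"
  assumes "f \<in> bump_algebra"
  shows "f differentiable_on UNIV \<and> (\<forall>j. partial j f \<in> bump_algebra)"
  using assms
proof induction
  case one
  then show ?case by (auto simp: partial_def[abs_def] intro: bump_algebra.zero)
next
  case zero
  then show ?case by (auto simp: partial_def[abs_def] intro: bump_algebra.zero)
next
  case (flat P s i a)
  define Q where "Q = [:0, 0, 1:] * (P - pderiv P)"
  have d: "((\<lambda>x. complex_of_real (flat P (s * (x $ i - a)))) has_derivative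
      (\<lambda>h. of_real (flat Q (s * (x $ i - a)) * (s * h $ i)))) (at x)" for x :: "real^'n"
  proof -
    have "(flat P has_derivative (\<lambda>h. flat Q (s * (x $ i - a)) * h)) (at (s * (x $ i - a)))"
      using flat_has_derivative[of P "s * (x $ i - a)"]
      by (simp add: has_field_derivative_def Q_def)
    moreover have "((\<lambda>x. s * (x $ i - a)) has_derivative (\<lambda>h. s * h $ i)) (at x)"
      using bounded_linear.has_derivative[OF bounded_linear_vec_nth has_derivative_ident]
      by (intro has_derivative_mult_right has_derivative_diff[where g' = "\<lambda>_. 0", simplified]) auto
    ultimately have "((\<lambda>x. flat P (s * (x $ i - a))) has_derivative
        (\<lambda>h. flat Q (s * (x $ i - a)) * (s * h $ i))) (at x)"
      by (rule has_derivative_compose[where f = "\<lambda>x. s * (x $ i - a)", rotated])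
    then show ?thesis by (rule has_derivative_of_real)
  qed
  \<comment> \<open>The chain rule factor \<open>s\<close> must go into the polynomial, as
    \<open>smult s Q\<close>, for the derivative to be a generator again.\<close>
  have "partial j (\<lambda>x. complex_of_real (flat P (s * (x $ i - a)))) =
      (if i = j then (\<lambda>x. complex_of_real (flat (smult s Q) (s * (x $ i - a)))) else (\<lambda>x. 0))" for j
    unfolding fun_eq_iff partial_eqI[OF d] by (auto simp: axis_def flat_def)
  then show ?case using d bump_algebra.flat bump_algebra.zero
    by (auto simp: differentiable_on_def differentiable_def)
next
  case (add f g)
  have d: "((\<lambda>x. f x + g x) has_derivative
      (\<lambda>h. frechet_derivative f (at x) h + frechet_derivative g (at x) h)) (at x)" for x
    using add.IH frechet_derivative_works
    by (intro has_derivative_add) (auto simp: differentiable_on_def)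
  have "partial j (\<lambda>x. f x + g x) = (\<lambda>x. partial j f x + partial j g x)" for j
    unfolding fun_eq_iff partial_eqI[OF d] by (simp add: partial_def)
  then show ?case using d add.IH
    by (auto simp: differentiable_on_def differentiable_def intro!: bump_algebra.add)
next
  case (mult f g)
  have d: "((\<lambda>x. f x * g x) has_derivative
      (\<lambda>h. f x * frechet_derivative g (at x) h + frechet_derivative f (at x) h * g x)) (at x)" for x
    using mult.IH frechet_derivative_works
    by (intro has_derivative_mult) (auto simp: differentiable_on_def)
  have "partial j (\<lambda>x. f x * g x) = (\<lambda>x. f x * partial j g x + partial j f x * g x)" for j
    unfolding fun_eq_iff partial_eqI[OF d] by (simp add: partial_def)
  moreover have "(\<lambda>x. f x * partial j g x + partial j f x * g x) \<in> bump_algebra" for j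
    using mult by (intro bump_algebra.add bump_algebra.mult) auto
  ultimately show ?case using d
    by (auto simp: differentiable_on_def differentiable_def)
qed

text \<open>The slope \<open>Suc k\<close> is positive for every \<open>k\<close>, so the zero set
  of each factor does not depend on \<open>k\<close>, while exp(- 1 / ((k + 1) t)) tends to 1 for
  fixed t > 0. The products therefore converge pointwise to the indicator of the open box and stay
  between 0 and 1.\<close>

definition bump :: "real^'n \<Rightarrow> real^'n \<Rightarrow> nat \<Rightarrow> real^'n \<Rightarrow> real" where
  "bump a b k x = (\<Prod>i\<in>UNIV. flat 1 (real (Suc k) * (x $ i - a $ i)) * flat 1 (real (Suc k) * (b $ i - x $ i)))"

lemma flat_one_range: "0 \<le> flat 1 t" "flat 1 t \<le> 1"
  by (auto simp: flat_def)

lemma bump_range: "0 \<le> bump a b k x" "bump a b k x \<le> 1"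
  unfolding bump_def by (intro prod_nonneg prod_le_1 mult_le_one conjI mult_nonneg_nonneg flat_one_range)+

lemma bump_nonzero: "bump a b k x \<noteq> 0 \<Longrightarrow> x \<in> box a b"
  unfolding bump_def mem_box_cart
  by (auto simp: flat_def zero_less_mult_iff split: if_splits dest!: spec)

lemma bump_test_function:
  fixes a b :: "real^'n"
  assumes "cbox a b \<subseteq> \<Omega>"
  shows "(\<lambda>x. complex_of_real (bump a b k x)) \<in> test_functions \<Omega>"
proof -
  \<comment> \<open>The factor that cuts off at \<open>b\<close> is rewritten with a negative slope,
    so that both factors have the shape of the generator \<open>bump_algebra.flat\<close>.\<close>
  have "(\<lambda>x. \<Prod>i\<in>I. complex_of_real (flat 1 (real (Suc k) * (x $ i - a $ i))) *
      complex_of_real (flat 1 (- real (Suc k) * (x $ i - b $ i)))) \<in> bump_algebra"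
    if "finite I" for I :: "'n set"
    using that
  proof (induction I)
    case empty
    then show ?case by (simp add: bump_algebra.one)
  next
    case (insert i I)
    then show ?case
      by (simp only: prod.insert not_False_eq_True) (intro bump_algebra.mult bump_algebra.flat)
  qed
  from this[of UNIV] have "(\<lambda>x. complex_of_real (bump a b k x)) \<in> bump_algebra"
    by (simp add: bump_def algebra_simps)
  then have "Ck m (\<lambda>x. complex_of_real (bump a b k x))" for m
    by (rule Ck_coinduct) (simp_all add: bump_algebra_derivative)
  moreover have c: "closure {x. complex_of_real (bump a b k x) \<noteq> 0} \<subseteq> cbox a b"
    using bump_nonzero box_subset_cbox by (intro closure_minimal) (auto, blast)
  moreover have "compact (closure {x. complex_of_real (bump a b k x) \<noteq> 0})"
    using c closed_Int_compact[of "closure {x. complex_of_real (bump a b k x) \<noteq> 0}" "cbox a b"]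
    by (simp add: Int_absorb2)
  moreover have "closure {x. complex_of_real (bump a b k x) \<noteq> 0} \<subseteq> \<Omega>"
    using c assms by simp
  ultimately show ?thesis unfolding test_functions_def by simp
qed

lemma bump_tendsto:
  fixes x :: "real^'n"
  shows "(\<lambda>k. bump a b k x) \<longlonglongrightarrow> indicator (box a b) x"
proof (cases "x \<in> box a b")
  case True
  have "(\<lambda>k. flat 1 (real (Suc k) * t)) \<longlonglongrightarrow> 1" if "t > 0" for t
  proof -
    have "(\<lambda>k. exp (- (1 / t * inverse (real (Suc k))))) \<longlonglongrightarrow> exp (- (1 / t * 0))"
      by (intro tendsto_intros LIMSEQ_inverse_real_of_nat)
    moreover have "flat 1 (real (Suc k) * t) = exp (- (1 / t * inverse (real (Suc k))))" for k
      using that by (simp add: flat_def divide_inverse zero_less_mult_iff mult.commute del: of_nat_Suc)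
    ultimately show ?thesis by simp
  qed
  then have "(\<lambda>k. bump a b k x) \<longlonglongrightarrow> (\<Prod>i\<in>(UNIV::'n set). 1 * 1)"
    unfolding bump_def using True by (intro tendsto_prod tendsto_mult) (auto simp: mem_box_cart)
  then show ?thesis using True by simp
next
  case False
  then have "bump a b k x = 0" for k using bump_nonzero by blast
  with False show ?thesis by simp
qed

section \<open>Multipliers that are singular only at the origin\<close>

inductive_set punctured_module :: "(real^'n \<Rightarrow> complex) set" where
  base: "(\<And>k. Ck k f) \<Longrightarrow> eventually (\<lambda>x. f x = 0) (nhds 0) \<Longrightarrow> f \<in> punctured_module"
| add: "f \<in> punctured_module \<Longrightarrow> g \<in> punctured_module \<Longrightarrow> (\<lambda>x. f x + g x) \<in> punctured_module"
| scale: "f \<in> punctured_module \<Longrightarrow> (\<lambda>x. c * f x) \<in> punctured_module"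
| coord: "f \<in> punctured_module \<Longrightarrow> (\<lambda>x. of_real (x $ i) * f x) \<in> punctured_module"
| inv_norm: "f \<in> punctured_module \<Longrightarrow> (\<lambda>x. inv_norm x * f x) \<in> punctured_module"

lemma inv_norm_has_derivative:
  fixes x :: "real^'n"
  assumes "x \<noteq> 0"
  shows "(inv_norm has_derivative (\<lambda>h. of_real (- (x \<bullet> h) / norm x ^ 3))) (at x)"
proof -
  have "((\<lambda>x. 1 / norm x) has_derivative (\<lambda>h. - (x \<bullet> h) / norm x ^ 3)) (at x)"
    using assms
    by (auto intro!: derivative_eq_intros has_derivative_norm simp: field_simps power3_eq_cube sgn_div_norm inner_commute)
  then show ?thesis unfolding inv_norm_def[abs_def] by (rule has_derivative_of_real)
qed

lemma coord_has_derivative: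
  "((\<lambda>x::real^'n. complex_of_real (x $ i)) has_derivative (\<lambda>h. of_real (h $ i))) (at x)"
  by (intro has_derivative_of_real bounded_linear_imp_has_derivative bounded_linear_vec_nth)

text \<open>The multiplier 1/|x| is not differentiable at the origin, so it occurs only in products
  with functions that vanish near 0. That vanishing is carried through the induction: it gives the
  derivative at the origin, and the product rule gives it elsewhere.\<close>

lemma punctured_module_derivative:
  fixes f :: "real^'n \<Rightarrow> complex"
  assumes "f \<in> punctured_module"
  shows "eventually (\<lambda>x. f x = 0) (nhds 0) \<and> f differentiable_on UNIV \<and> (\<forall>j. partial j f \<in> punctured_module)"
  using assms
proof induction
  case (base f)
  have "eventually (\<lambda>x. partial j f x = 0) (nhds 0)" for j
    by (rule eventually_mono[OF iffD2[OF eventually_eventually base(2)]])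
      (rule partial_eq_0_if_locally_0(2))
  then show ?case using base smooth_differentiable[OF base(1)]
    by (auto intro!: punctured_module.base smooth_partial)
next
  case (add f g)
  have d: "((\<lambda>x. f x + g x) has_derivative
      (\<lambda>h. frechet_derivative f (at x) h + frechet_derivative g (at x) h)) (at x)" for x
    using add.IH frechet_derivative_works
    by (intro has_derivative_add) (auto simp: differentiable_on_def)
  have "partial j (\<lambda>x. f x + g x) = (\<lambda>x. partial j f x + partial j g x)" for j
    unfolding fun_eq_iff partial_eqI[OF d] by (simp add: partial_def)
  moreover have "eventually (\<lambda>x. f x + g x = 0) (nhds 0)"
    by (rule eventually_elim2[OF add.IH(1)[THEN conjunct1] add.IH(2)[THEN conjunct1]]) simp
  ultimately show ?case using d add.IH
    by (auto simp: differentiable_on_def differentiable_def intro!: punctured_module.add)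
next
  case (scale f c)
  have d: "((\<lambda>x. c * f x) has_derivative (\<lambda>h. c * frechet_derivative f (at x) h)) (at x)" for x
    using scale.IH frechet_derivative_works
    by (intro has_derivative_mult_right) (auto simp: differentiable_on_def)
  have "partial j (\<lambda>x. c * f x) = (\<lambda>x. c * partial j f x)" for j
    unfolding fun_eq_iff partial_eqI[OF d] by (simp add: partial_def)
  moreover have "eventually (\<lambda>x. c * f x = 0) (nhds 0)"
    by (rule eventually_mono[OF scale.IH[THEN conjunct1]]) simp
  ultimately show ?case using d scale.IH
    by (auto simp: differentiable_on_def differentiable_def intro!: punctured_module.scale)
next
  case (coord f i)
  have d: "((\<lambda>x. of_real (x $ i) * f x) has_derivative
      (\<lambda>h. of_real (x $ i) * frechet_derivative f (at x) h + of_real (h $ i) * f x)) (at x)" for x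
    using coord.IH frechet_derivative_works
    by (intro has_derivative_mult coord_has_derivative) (auto simp: differentiable_on_def)
  have "partial j (\<lambda>x. of_real (x $ i) * f x) =
      (\<lambda>x. of_real (x $ i) * partial j f x + (if i = j then 1 else 0) * f x)" for j
    unfolding fun_eq_iff partial_eqI[OF d] by (simp add: partial_def axis_def)
  moreover have "(\<lambda>x. of_real (x $ i) * partial j f x + (if i = j then 1 else 0) * f x) \<in> punctured_module" for j
    using coord by (intro punctured_module.add punctured_module.scale punctured_module.coord) auto
  moreover have "eventually (\<lambda>x. of_real (x $ i) * f x = 0) (nhds 0)"
    by (rule eventually_mono[OF coord.IH[THEN conjunct1]]) simp
  ultimately show ?case using d coord
    by (auto simp: differentiable_on_def differentiable_def)
next
  case (inv_norm f)
  have ev: "eventually (\<lambda>x. inv_norm x * f x = 0) (nhds 0)"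
    by (rule eventually_mono[OF inv_norm.IH[THEN conjunct1]]) simp
  have d: "((\<lambda>x. inv_norm x * f x) has_derivative
      (\<lambda>h. inv_norm x * frechet_derivative f (at x) h + of_real (- (x \<bullet> h) / norm x ^ 3) * f x)) (at x)"
    if "x \<noteq> 0" for x
    using inv_norm.IH frechet_derivative_works that
    by (intro has_derivative_mult inv_norm_has_derivative) (auto simp: differentiable_on_def)
  \<comment> \<open>The derivative - x_j / |x|^3 of 1/|x| is spelled out as repeated multiplication
    by generators, so that the result visibly lies in the module. At the origin the right side is 0
    because \<open>inv_norm 0 = 0\<close>, and the left side because the product vanishes
    nearby.\<close>
  have p: "partial j (\<lambda>x. inv_norm x * f x) = (\<lambda>x. inv_norm x * partial j f x +
      (- 1) * (of_real (x $ j) * (inv_norm x * (inv_norm x * (inv_norm x * f x)))))" for j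
  proof
    fix x
    show "partial j (\<lambda>x. inv_norm x * f x) x = inv_norm x * partial j f x +
      (- 1) * (of_real (x $ j) * (inv_norm x * (inv_norm x * (inv_norm x * f x))))"
    proof (cases "x = 0")
      case True
      then show ?thesis using partial_eq_0_if_locally_0(2)[OF ev, of j]
        by (simp add: inv_norm_def)
    next
      case False
      then show ?thesis
        unfolding partial_eqI[OF d[OF False]]
        by (simp add: partial_def inner_axis inv_norm_def power3_eq_cube)
    qed
  qed
  have "(\<lambda>x. inv_norm x * f x) differentiable at x" for x
    using d partial_eq_0_if_locally_0(1)[OF ev] by (cases "x = 0") (auto simp: differentiable_def)
  moreover have "partial j (\<lambda>x. inv_norm x * f x) \<in> punctured_module" for j
    unfolding p using inv_norm by (intro punctured_module.add punctured_module.scale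
        punctured_module.coord punctured_module.inv_norm) auto
  ultimately show ?case using ev by (simp add: differentiable_on_def)
qed

lemma punctured_module_smooth: "f \<in> punctured_module \<Longrightarrow> Ck k f"
  by (rule Ck_coinduct[where S = punctured_module]) (simp_all add: punctured_module_derivative)

lemma test_functions_punctured_0:
  assumes "\<psi> \<in> test_functions punctured"
  shows "eventually (\<lambda>x. \<psi> x = 0) (nhds 0)"
proof -
  have "0 \<in> - closure {x. \<psi> x \<noteq> 0}" "open (- closure {x. \<psi> x \<noteq> 0})"
    using assms by (auto simp: test_functions_def punctured_def)
  moreover have "\<psi> y = 0" if "y \<in> - closure {x. \<psi> x \<noteq> 0}" for y
    using that closure_subset[of "{x. \<psi> x \<noteq> 0}"] by blast
  ultimately show ?thesis unfolding eventually_nhds by metis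
qed

text \<open>This makes \<open>radial_grad\<close> meaningful:
  \<open>dist_mult (unit_radial j)\<close> evaluates the distribution at an admissible test
  function.\<close>

lemma test_functions_punctured_mult_unit_radial:
  assumes "\<psi> \<in> test_functions punctured"
  shows "(\<lambda>x. unit_radial j x * \<psi> x) \<in> test_functions punctured"
proof -
  have "\<psi> \<in> punctured_module"
    using assms test_functions_punctured_0 by (intro punctured_module.base) (auto simp: test_functions_def)
  then have "(\<lambda>x. of_real (x $ j) * (inv_norm x * \<psi> x)) \<in> punctured_module"
    by (intro punctured_module.coord punctured_module.inv_norm)
  also have "(\<lambda>x. of_real (x $ j) * (inv_norm x * \<psi> x)) = (\<lambda>x. unit_radial j x * \<psi> x)"
    by (simp add: unit_radial_def inv_norm_def)
  finally have "Ck k (\<lambda>x. unit_radial j x * \<psi> x)" for k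
    by (rule punctured_module_smooth)
  moreover have c: "closure {x. unit_radial j x * \<psi> x \<noteq> 0} \<subseteq> closure {x. \<psi> x \<noteq> 0}"
    by (intro closure_mono) auto
  moreover have "compact (closure {x. unit_radial j x * \<psi> x \<noteq> 0})"
    using assms c closed_Int_compact[of "closure {x. unit_radial j x * \<psi> x \<noteq> 0}" "closure {x. \<psi> x \<noteq> 0}"]
    by (simp add: test_functions_def Int_absorb2)
  moreover have "closure {x. \<psi> x \<noteq> 0} \<subseteq> punctured"
    using assms by (simp add: test_functions_def)
  ultimately show ?thesis unfolding test_functions_def by (simp del: compact_closure)
qed

lemma unit_radial_partial_mult:
  assumes "\<psi> \<in> test_functions punctured" "x \<noteq> 0"
  shows "partial j (\<lambda>x. unit_radial j x * \<psi> x) x =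
    unit_radial j x * partial j \<psi> x + (inv_norm x - of_real ((x $ j)\<^sup>2) * inv_norm x ^ 3) * \<psi> x"
proof -
  have d: "((\<lambda>x. (of_real (x $ j) * inv_norm x) * \<psi> x) has_derivative
     (\<lambda>h. of_real (x $ j) * inv_norm x * frechet_derivative \<psi> (at x) h +
      (of_real (x $ j) * of_real (- (x \<bullet> h) / norm x ^ 3) + of_real (h $ j) * inv_norm x) * \<psi> x)) (at x)"
    using assms by (intro has_derivative_mult coord_has_derivative inv_norm_has_derivative smooth_has_derivative)
      (auto simp: test_functions_def)
  have "(\<lambda>x. unit_radial j x * \<psi> x) = (\<lambda>x. (of_real (x $ j) * inv_norm x) * \<psi> x)"
    by (simp add: unit_radial_def inv_norm_def)
  then show ?thesis
    by (simp only: partial_eqI[OF d])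
      (simp add: partial_def[of j \<psi>] inner_axis unit_radial_def inv_norm_def power2_eq_square
        power3_eq_cube algebra_simps)
qed

text \<open>The squares of the coordinates add up to |x|^2, so the subtracted terms amount to a
  single 1/|x|. The summands are the factors of \<psi> in \<open>unit_radial_partial_mult\<close>,
  and the sum is the divergence of x/|x|.\<close>

lemma unit_radial_div:
  fixes x :: "real^'n"
  assumes "x \<noteq> 0"
  shows "(\<Sum>j\<in>UNIV. inv_norm x - of_real ((x $ j)\<^sup>2) * inv_norm x ^ 3) = (of_nat CARD('n) - 1) * inv_norm x"
proof -
  have "(\<Sum>j\<in>UNIV. (x $ j)\<^sup>2) = (norm x)\<^sup>2"
    unfolding power2_norm_eq_inner inner_vec_def by (simp add: power2_eq_square)
  then have "(\<Sum>j\<in>UNIV. of_real ((x $ j)\<^sup>2) * inv_norm x ^ 3) = of_real ((norm x)\<^sup>2) * inv_norm x ^ 3"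
    by (metis (no_types) of_real_sum sum_distrib_right)
  also have "\<dots> = inv_norm x"
    using assms by (simp add: inv_norm_def power2_eq_square power3_eq_cube)
  finally show ?thesis by (simp add: sum_subtractf algebra_simps)
qed

subsection \<open>Square integrable functions\<close>

lemma AE_lebesgue_iff: "(AE x in lebesgue. P x) \<longleftrightarrow> (AE x in lborel. P x)"
  by (rule AE_completion_iff)

lemma L2_D:
  assumes "f \<in> L2"
  shows "f \<in> borel_measurable lebesgue" "integrable lebesgue (\<lambda>x. (cmod (f x))\<^sup>2)"
  using assms by (auto simp: L2_def)

lemma L2_bound:
  assumes "f \<in> L2" "g \<in> borel_measurable lebesgue" "\<And>x. cmod (g x) \<le> C * cmod (f x)"
  shows "g \<in> L2"
proof -
  have "integrable lebesgue (\<lambda>x. C\<^sup>2 * (cmod (f x))\<^sup>2)" using L2_D[OF assms(1)] by simp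
  then have "integrable lebesgue (\<lambda>x. (cmod (g x))\<^sup>2)"
  proof (rule Bochner_Integration.integrable_bound)
    show "(\<lambda>x. (cmod (g x))\<^sup>2) \<in> borel_measurable lebesgue" using assms(2) by measurable
    have "(cmod (g x))\<^sup>2 \<le> C\<^sup>2 * (cmod (f x))\<^sup>2" for x
      using power_mono[OF assms(3), of x 2] by (simp add: power_mult_distrib)
    then show "AE x in lebesgue. norm ((cmod (g x))\<^sup>2) \<le> norm (C\<^sup>2 * (cmod (f x))\<^sup>2)" by simp
  qed
  then show ?thesis using assms(2) by (simp add: L2_def)
qed

lemma norm_add_squared_le: "(norm (a + b))\<^sup>2 \<le> 2 * (norm a)\<^sup>2 + 2 * (norm (b::'a::real_normed_vector))\<^sup>2"
proof -
  have "(norm (a + b))\<^sup>2 \<le> (norm a + norm b)\<^sup>2" by (intro power_mono norm_triangle_ineq) auto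
  also have "\<dots> \<le> 2 * (norm a)\<^sup>2 + 2 * (norm b)\<^sup>2"
    using sum_squares_bound[of "norm a" "norm b"] by (simp add: power2_sum)
  finally show ?thesis .
qed

lemma L2_add:
  assumes "f \<in> L2" "g \<in> L2"
  shows "(\<lambda>x. f x + g x) \<in> L2"
proof -
  have [measurable]: "f \<in> borel_measurable lebesgue" "g \<in> borel_measurable lebesgue"
    using assms by (auto simp: L2_def)
  have "integrable lebesgue (\<lambda>x. 2 * (cmod (f x))\<^sup>2 + 2 * (cmod (g x))\<^sup>2)"
    using L2_D[OF assms(1)] L2_D[OF assms(2)] by simp
  then have "integrable lebesgue (\<lambda>x. (cmod (f x + g x))\<^sup>2)"
    by (rule Bochner_Integration.integrable_bound) (auto intro!: AE_I2 norm_add_squared_le)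
  then show ?thesis by (simp add: L2_def)
qed

lemma L2_scale: "f \<in> L2 \<Longrightarrow> (\<lambda>x. c * f x) \<in> L2"
  by (rule L2_bound[of f _ "cmod c"]) (auto simp: L2_def norm_mult)

lemma L2_diff: "f \<in> L2 \<Longrightarrow> g \<in> L2 \<Longrightarrow> (\<lambda>x. f x - g x) \<in> L2"
  using L2_add[of f "\<lambda>x. (-1) * g x"] L2_scale[of g "-1"] by simp

lemma L2_sum: "finite I \<Longrightarrow> (\<And>i. i \<in> I \<Longrightarrow> f i \<in> L2) \<Longrightarrow> (\<lambda>x. \<Sum>i\<in>I. f i x) \<in> L2"
proof (induction I rule: finite_induct)
  case empty
  then show ?case by (simp add: L2_def)
next
  case (insert i I)
  then show ?case by (simp add: L2_add)
qed

lemma L2_cong_AE: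
  assumes "f \<in> L2" "g \<in> borel_measurable lebesgue" "AE x in lebesgue. f x = g x"
  shows "g \<in> L2"
proof -
  have "integrable lebesgue (\<lambda>x. (cmod (g x))\<^sup>2) \<longleftrightarrow> integrable lebesgue (\<lambda>x. (cmod (f x))\<^sup>2)"
    using assms by (intro integrable_cong_AE) (auto simp: L2_def)
  then show ?thesis using assms by (simp add: L2_def)
qed

lemma L2_mult_integrable:
  assumes "f \<in> L2" "g \<in> L2"
  shows "integrable lebesgue (\<lambda>x. f x * g x)"
proof (rule Bochner_Integration.integrable_bound)
  have [measurable]: "f \<in> borel_measurable lebesgue" "g \<in> borel_measurable lebesgue"
    using assms by (auto simp: L2_def)
  show "integrable lebesgue (\<lambda>x. (cmod (f x))\<^sup>2 + (cmod (g x))\<^sup>2)"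
    using L2_D[OF assms(1)] L2_D[OF assms(2)] by simp
  show "(\<lambda>x. f x * g x) \<in> borel_measurable lebesgue" by measurable
  have "cmod (f x) * cmod (g x) \<le> (cmod (f x))\<^sup>2 + (cmod (g x))\<^sup>2" for x
    using sum_squares_bound[of "cmod (f x)" "cmod (g x)"]
      zero_le_power2[of "cmod (f x)"] zero_le_power2[of "cmod (g x)"] by linarith
  then show "AE x in lebesgue. norm (f x * g x) \<le> norm ((cmod (f x))\<^sup>2 + (cmod (g x))\<^sup>2)"
    by (simp add: norm_mult)
qed

lemma complex_measurable_cnj [measurable (raw)]:
  "f \<in> borel_measurable M \<Longrightarrow> (\<lambda>x. cnj (f x)) \<in> borel_measurable M"
  by (rule measurable_compose[OF _ borel_measurable_continuous_onI[OF continuous_on_cnj[OF continuous_on_id]]])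

lemma L2_cnj: "f \<in> L2 \<Longrightarrow> (\<lambda>x. cnj (f x)) \<in> L2"
  by (simp add: L2_def complex_measurable_cnj)

lemma L2_mult_bounded:
  assumes "f \<in> L2" "g \<in> borel_measurable lebesgue" "\<And>x. cmod (g x) \<le> C"
  shows "(\<lambda>x. g x * f x) \<in> L2"
proof (rule L2_bound[OF assms(1)])
  show "(\<lambda>x. g x * f x) \<in> borel_measurable lebesgue"
    using assms by (intro borel_measurable_times) (simp_all add: L2_def)
  show "cmod (g x * f x) \<le> C * cmod (f x)" for x
    unfolding norm_mult by (intro mult_right_mono assms(3)) simp
qed

text \<open>A function measurable for the completed measure agrees almost everywhere with a Borel
  function; real and imaginary parts are treated separately and recombined.\<close>

lemma L2_borel_representative:
  assumes "f \<in> L2"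
  obtains g where "g \<in> borel_measurable borel" "g \<in> L2" "AE x in lebesgue. f x = g x"
proof -
  have "f \<in> borel_measurable lebesgue" using assms by (simp add: L2_def)
  then have "(\<lambda>x. Re (f x)) \<in> borel_measurable lebesgue" "(\<lambda>x. Im (f x)) \<in> borel_measurable lebesgue"
    by measurable
  from this[THEN completion_ex_borel_measurable_real] obtain u v
    where uv: "u \<in> borel_measurable lborel" "v \<in> borel_measurable lborel"
      and ae: "AE x in lborel. Re (f x) = u x" "AE x in lborel. Im (f x) = v x" by blast
  define g where "g x = complex_of_real (u x) + \<i> * of_real (v x)" for x
  have g: "g \<in> borel_measurable borel"
    using uv unfolding g_def[abs_def] by measurable
  then have "g \<in> borel_measurable lebesgue" by (simp add: measurable_completion)
  moreover have ae: "AE x in lebesgue. f x = g x"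
    unfolding AE_lebesgue_iff using ae by eventually_elim (simp add: g_def complex_eq_iff)
  ultimately show ?thesis using that[OF g] L2_cong_AE[OF assms] by metis
qed

section \<open>Testing square integrable functions\<close>

lemma test_functions_continuous: "\<psi> \<in> test_functions \<Omega> \<Longrightarrow> continuous_on UNIV \<psi>"
  unfolding test_functions_def by (metis (no_types, lifting) Ck.simps(1) mem_Collect_eq)

lemma test_functions_mono: "\<Omega> \<subseteq> \<Omega>' \<Longrightarrow> test_functions \<Omega> \<subseteq> test_functions \<Omega>'"
  by (auto simp: test_functions_def)

lemma compact_support_bounded:
  fixes \<psi> :: "real^'n \<Rightarrow> complex"
  assumes "\<psi> \<in> test_functions \<Omega>"
  obtains M a b where "0 \<le> M" "\<And>x. cmod (\<psi> x) \<le> M * indicator (cbox a b) x"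
proof -
  define K where "K = closure {x. \<psi> x \<noteq> 0}"
  have K: "compact K" using assms by (simp add: K_def test_functions_def)
  have "continuous_on K \<psi>" using test_functions_continuous[OF assms] continuous_on_subset by blast
  from compact_imp_bounded[OF compact_continuous_image[OF this K]]
  obtain M where M: "M > 0" "\<And>x. x \<in> K \<Longrightarrow> cmod (\<psi> x) \<le> M"
    by (auto simp: bounded_pos)
  obtain a where a: "K \<subseteq> cbox (- a) a"
    using bounded_subset_cbox_symmetric[OF compact_imp_bounded[OF K]] by blast
  have "cmod (\<psi> x) \<le> M * indicator (cbox (- a) a) x" for x
  proof (cases "\<psi> x = 0")
    case False
    then have "x \<in> K" using closure_subset[of "{x. \<psi> x \<noteq> 0}"] unfolding K_def by blast
    then show ?thesis using M a by auto
  qed (use M in auto)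
  then show ?thesis using M that[of M] by (metis less_imp_le)
qed

lemma test_functions_measurable: "\<psi> \<in> test_functions \<Omega> \<Longrightarrow> \<psi> \<in> borel_measurable borel"
  using test_functions_continuous borel_measurable_continuous_onI by blast

lemma indicator_cbox_L2: "(\<lambda>x::real^'n. complex_of_real (indicator (cbox a b) x)) \<in> L2"
proof -
  have "integrable lebesgue (\<lambda>x::real^'n. indicat_real (cbox a b) x)"
    using lmeasurable_cbox[of a b] by (simp add: fmeasurable_def)
  moreover have "(cmod (complex_of_real (indicator (cbox a b) x)))\<^sup>2 = indicat_real (cbox a b) x" for x :: "real^'n"
    by (simp add: indicator_def)
  ultimately show ?thesis by (simp add: L2_def)
qed

lemma test_functions_L2:
  assumes "\<psi> \<in> test_functions \<Omega>"
  shows "\<psi> \<in> L2"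
proof -
  obtain M a b where M: "\<And>x. cmod (\<psi> x) \<le> M * indicator (cbox a b) x"
    using compact_support_bounded[OF assms] by metis
  show ?thesis
  proof (rule L2_bound[OF indicator_cbox_L2[of a b]])
    show "\<psi> \<in> borel_measurable lebesgue"
      using test_functions_measurable[OF assms] by (simp add: measurable_completion)
    show "cmod (\<psi> x) \<le> M * cmod (complex_of_real (indicator (cbox a b) x))" for x
      using M[of x] by simp
  qed
qed

lemma L2_integrable_on_cbox:
  assumes "f \<in> L2"
  shows "set_integrable lebesgue (cbox a b) f"
  using L2_mult_integrable[OF indicator_cbox_L2[of a b] assms]
  by (simp add: set_integrable_def scaleR_conv_of_real)

text \<open>The bumps of the box are admissible test functions and converge to the indicator of its
  interior. An \<open>L2\<close> function is integrable on the bounded box, which provides the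
  dominating function; passing from the open to the closed box does not change the integral.\<close>

lemma integral_cbox_eq_0_if_test:
  fixes f :: "real^'n \<Rightarrow> complex"
  assumes f: "f \<in> L2" and test: "\<And>\<psi>. \<psi> \<in> test_functions \<Omega> \<Longrightarrow> (LINT x|lebesgue. f x * \<psi> x) = 0"
    and ab: "cbox a b \<subseteq> \<Omega>"
  shows "integral (cbox a b) f = 0"
proof -
  have [measurable]: "f \<in> borel_measurable lebesgue" using f by (simp add: L2_def)
  have bump_L2: "(\<lambda>x. complex_of_real (bump a b k x)) \<in> L2" for k
    by (rule test_functions_L2[OF bump_test_function[OF ab]])
  have "(\<lambda>k. LINT x|lebesgue. f x * of_real (bump a b k x)) \<longlonglongrightarrow>
      (LINT x|lebesgue. f x * of_real (indicator (box a b) x))"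
  proof (rule integral_dominated_convergence)
    have "(\<lambda>x. complex_of_real (indicator (box a b) x)) \<in> borel_measurable borel"
      by measurable
    then have "(\<lambda>x. complex_of_real (indicator (box a b) x)) \<in> borel_measurable lebesgue"
      by (simp add: measurable_completion)
    then show "(\<lambda>x. f x * of_real (indicator (box a b) x)) \<in> borel_measurable lebesgue"
      by (intro borel_measurable_times) simp_all
    show "(\<lambda>x. f x * of_real (bump a b k x)) \<in> borel_measurable lebesgue" for k
      by (rule borel_measurable_integrable[OF L2_mult_integrable[OF f bump_L2]])
    show "integrable lebesgue (\<lambda>x. cmod (of_real (indicator (cbox a b) x) * f x))"
      by (intro integrable_norm L2_mult_integrable f indicator_cbox_L2)
    show "AE x in lebesgue. (\<lambda>k. f x * of_real (bump a b k x)) \<longlonglongrightarrow> f x * of_real (indicator (box a b) x)"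
      by (intro AE_I2 tendsto_intros bump_tendsto)
    have "bump a b k x \<le> indicator (cbox a b) x" for k x
      using bump_range[of a b k x] bump_nonzero[of a b k x] box_subset_cbox[of a b]
      by (auto simp: indicator_def)
    then show "AE x in lebesgue. norm (f x * of_real (bump a b k x)) \<le> cmod (of_real (indicator (cbox a b) x) * f x)" for k
      using bump_range(1)[of a b k] by (intro AE_I2) (simp add: norm_mult mult.commute mult_left_mono)
  qed
  then have "(LINT x|lebesgue. f x * of_real (indicator (box a b) x)) = 0"
    unfolding test[OF bump_test_function[OF ab]] by (simp add: LIMSEQ_const_iff)
  then have "(LINT x:box a b|lebesgue. f x) = 0"
    by (simp add: set_lebesgue_integral_def scaleR_conv_of_real mult.commute)
  moreover have "set_integrable lebesgue (box a b) f"
    by (rule set_integrable_subset[OF L2_integrable_on_cbox[OF f, of a b]]) (auto simp: box_subset_cbox)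
  ultimately have "integral (box a b) f = 0"
    by (simp add: set_lebesgue_integral_eq_integral)
  then show ?thesis by (simp add: integral_open_interval)
qed

text \<open>By Lebesgue differentiation, the averages of \<open>f\<close> over small cubes with
  corner \<open>x\<close> tend to \<open>f x\<close> for almost every \<open>x\<close>. Cubes inside
  \<Omega> have integral 0 by the preceding lemma, so a nonzero value of \<open>f x\<close> would
  violate the estimate with error \<open>cmod (f x)\<close>.\<close>

lemma fundamental_lemma_calculus_of_variations:
  fixes f :: "real^'n \<Rightarrow> complex"
  assumes f: "f \<in> L2" and test: "\<And>\<psi>. \<psi> \<in> test_functions \<Omega> \<Longrightarrow> (LINT x|lebesgue. f x * \<psi> x) = 0"
    and "open \<Omega>" and null: "- \<Omega> \<in> null_sets lebesgue"
  shows "AE x in lebesgue. f x = 0"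
proof -
  have "f integrable_on cbox a b" for a b
    by (rule set_lebesgue_integral_eq_integral(1)[OF L2_integrable_on_cbox[OF f]])
  from integrable_ccontinuous_explicit[OF this] obtain N where N: "negligible N"
    "\<And>x e. x \<notin> N \<Longrightarrow> 0 < e \<Longrightarrow> \<exists>d>0. \<forall>h. 0 < h \<and> h < d \<longrightarrow>
       norm (integral (cbox x (x + h *\<^sub>R One)) f /\<^sub>R h ^ DIM(real^'n) - f x) < e" by metis
  have *: "f x = 0" if x: "x \<notin> N" "x \<in> \<Omega>" for x
  proof (rule ccontr)
    assume "f x \<noteq> 0"
    then obtain d where d: "d > 0" "\<And>h. 0 < h \<Longrightarrow> h < d \<Longrightarrow>
       norm (integral (cbox x (x + h *\<^sub>R One)) f /\<^sub>R h ^ DIM(real^'n) - f x) < cmod (f x)"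
      using N(2)[OF x(1), of "cmod (f x)"] by auto
    obtain r where r: "r > 0" "ball x r \<subseteq> \<Omega>" using \<open>open \<Omega>\<close> x by (meson open_contains_ball)
    define O' where "O' = (One :: real^'n)"
    \<comment> \<open>The first bound serves the differentiation estimate. The second keeps the
      diagonal of the cube, of length h |One|, below \<open>r\<close>, so that the cube lies in the
      ball inside \<Omega>.\<close>
    define h where "h = min (d / 2) (r / (2 * (norm O' + 1)))"
    have n: "norm O' + 1 > 0" using norm_ge_zero[of O'] by linarith
    then have h: "0 < h" "h < d" "h \<le> r / (2 * (norm O' + 1))"
      using d r by (auto simp: h_def min_less_iff_disj)
    have "cbox x (x + h *\<^sub>R One) \<subseteq> \<Omega>"
    proof
      fix y assume y: "y \<in> cbox x (x + h *\<^sub>R One)"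
      have "norm (y - x) \<le> norm (h *\<^sub>R O')"
      proof (rule norm_le_componentwise)
        fix b :: "real^'n" assume b: "b \<in> Basis"
        have "(x + h *\<^sub>R One) \<bullet> b = x \<bullet> b + h" using b by (simp add: inner_add_left)
        then have "x \<bullet> b \<le> y \<bullet> b \<and> y \<bullet> b \<le> x \<bullet> b + h" using y b by (metis mem_box(2))
        moreover have "O' \<bullet> b = 1" using b by (simp add: O'_def)
        ultimately show "\<bar>(y - x) \<bullet> b\<bar> \<le> \<bar>(h *\<^sub>R O') \<bullet> b\<bar>" by (simp add: inner_diff_left)
      qed
      also have "\<dots> \<le> r / (2 * (norm O' + 1)) * norm O'"
        using h mult_right_mono[OF h(3), of "norm O'"] by simp
      also have "\<dots> < r" using n r by (simp add: field_simps) (smt (verit) mult_nonneg_nonneg norm_ge_zero)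
      finally show "y \<in> \<Omega>" using r(2) by (auto simp: dist_norm norm_minus_commute subset_iff)
    qed
    from integral_cbox_eq_0_if_test[OF f test this] d(2)[OF h(1,2)] show False by simp
  qed
  have "AE x in lebesgue. x \<notin> N" using N(1) by (simp add: negligible_iff_null_sets AE_not_in)
  moreover have "AE x in lebesgue. x \<notin> - \<Omega>" by (rule AE_not_in[OF null])
  ultimately show ?thesis by eventually_elim (simp add: *)
qed

text \<open>This justifies the choice made by \<open>L2_rep\<close>: the difference of two
  representatives is annihilated by every test function.\<close>

lemma L2_represents_AE_unique:
  assumes "L2_represents \<Omega> T f" "L2_represents \<Omega> T g" "open \<Omega>" "- \<Omega> \<in> null_sets lebesgue"
  shows "AE x in lebesgue. f x = g x"
proof -
  have fg: "f \<in> L2" "g \<in> L2" using assms by (auto simp: L2_represents_def)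
  have "AE x in lebesgue. f x - g x = 0"
  proof (rule fundamental_lemma_calculus_of_variations[OF L2_diff[OF fg] _ assms(3,4)])
    fix \<psi> :: "real^'a \<Rightarrow> complex" assume t: "\<psi> \<in> test_functions \<Omega>"
    have "(LINT x|lebesgue. (f x - g x) * \<psi> x) = dist_of f \<psi> - dist_of g \<psi>"
      unfolding dist_of_def left_diff_distrib
      by (intro Bochner_Integration.integral_diff L2_mult_integrable fg test_functions_L2[OF t])
    then show "(LINT x|lebesgue. (f x - g x) * \<psi> x) = 0"
      using assms t unfolding L2_represents_def by (metis right_minus_eq)
  qed
  then show ?thesis by simp
qed

lemma L2_represents_L2_rep: "L2_represents \<Omega> T g \<Longrightarrow> L2_represents \<Omega> T (L2_rep \<Omega> T)"
  unfolding L2_rep_def by (rule someI[of "L2_represents \<Omega> T"])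

lemma L2_rep_AE_eq:
  assumes "L2_represents \<Omega> T g" "open \<Omega>" "- \<Omega> \<in> null_sets lebesgue"
  shows "AE x in lebesgue. L2_rep \<Omega> T x = g x"
  using L2_represents_AE_unique[OF L2_represents_L2_rep[OF assms(1)] assms] .

lemma punctured_open: "open punctured" "- punctured \<in> null_sets lebesgue"
  by (auto simp: punctured_def)

subsection \<open>Weak derivatives and difference quotients\<close>

lemma lborel_integral_translate:
  fixes g :: "'a::euclidean_space \<Rightarrow> 'b::{banach, second_countable_topology}"
  assumes "g \<in> borel_measurable borel"
  shows "(LINT x|lborel. g (x + c)) = (LINT x|lborel. g x)"
    and "integrable lborel (\<lambda>x. g (x + c)) \<longleftrightarrow> integrable lborel g"
proof -
  have m: "(+) c \<in> lborel \<rightarrow>\<^sub>M borel" by simp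
  show "(LINT x|lborel. g (x + c)) = (LINT x|lborel. g x)"
    using integral_distr[OF m, of g] assms by (simp add: lborel_distr_plus add.commute)
  show "integrable lborel (\<lambda>x. g (x + c)) \<longleftrightarrow> integrable lborel g"
    using integrable_distr_eq[OF m, of g] assms by (simp add: lborel_distr_plus add.commute)
qed

text \<open>By translation invariance the inner integral of |u| over x is the same for every t, and
  the strip has finite width. This licenses every exchange of the integrations over t and x.\<close>

lemma integrable_strip:
  fixes u :: "real^'n \<Rightarrow> real"
  assumes u [measurable]: "u \<in> borel_measurable borel" and int: "integrable lborel u"
  shows "integrable (lborel \<Otimes>\<^sub>M lborel) (\<lambda>(t, x). indicator {0..h} t * u (x + t *\<^sub>R v))"
proof (rule lborel_pair.Fubini_integrable)
  show "(\<lambda>(t, x). indicator {0..h} t * u (x + t *\<^sub>R v)) \<in> borel_measurable (lborel \<Otimes>\<^sub>M lborel)"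
    by measurable
  have "(LINT x|lborel. norm (indicator {0..h} t * u (x + t *\<^sub>R v))) =
      indicator {0..h} t * (LINT x|lborel. \<bar>u x\<bar>)" for t
    using lborel_integral_translate(1)[of "\<lambda>x. \<bar>u x\<bar>" "t *\<^sub>R v"] by (simp add: abs_mult)
  moreover have "integrable lborel (\<lambda>t::real. indicat_real {0..h} t * (LINT x|lborel. \<bar>u x\<bar>))"
    by (intro integrable_mult_left integrable_real_indicator) (auto simp: emeasure_lborel_Icc_eq)
  ultimately show "integrable lborel (\<lambda>t. LINT x|lborel. norm (case (t, x) of (t, x) \<Rightarrow>
      indicator {0..h} t * u (x + t *\<^sub>R v)))" by simp
  show "AE t in lborel. integrable lborel (\<lambda>x. case (t, x) of (t, x) \<Rightarrow>
      indicator {0..h} t * u (x + t *\<^sub>R v))"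
    using int by (simp add: lborel_integral_translate(2)[OF u])
qed

text \<open>The shape of the bound is that of |a b| \<le> |a|^2 + |b|^2 applied to a product with
  one translated and one fixed factor.\<close>

lemma integrable_strip_bound:
  fixes u w :: "real^'n \<Rightarrow> real" and G :: "real \<Rightarrow> real^'n \<Rightarrow> complex"
  assumes [measurable]: "u \<in> borel_measurable borel" "w \<in> borel_measurable borel"
    and "integrable lborel u" "integrable lborel w"
    and [measurable]: "(\<lambda>(t, x). G t x) \<in> borel_measurable (lborel \<Otimes>\<^sub>M lborel)"
    and bound: "\<And>t x. norm (G t x) \<le> u (x + t *\<^sub>R v) + w x"
  shows "integrable (lborel \<Otimes>\<^sub>M lborel) (\<lambda>(t, x). indicator {0..h} t *\<^sub>R G t x)"
proof (rule Bochner_Integration.integrable_bound)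
  \<comment> \<open>The fixed term \<open>w\<close> is also a strip, along the direction 0.\<close>
  have "integrable (lborel \<Otimes>\<^sub>M lborel) (\<lambda>p. (case p of (t, x) \<Rightarrow> indicator {0..h} t * u (x + t *\<^sub>R v))
      + (case p of (t, x) \<Rightarrow> indicator {0..h} t * w (x + t *\<^sub>R 0)))"
    using assms by (intro Bochner_Integration.integrable_add integrable_strip)
  then show "integrable (lborel \<Otimes>\<^sub>M lborel) (\<lambda>(t, x). indicator {0..h} t * (u (x + t *\<^sub>R v) + w x))"
    by (simp add: case_prod_beta' algebra_simps)
  show "(\<lambda>(t, x). indicator {0..h} t *\<^sub>R G t x) \<in> borel_measurable (lborel \<Otimes>\<^sub>M lborel)"
    by measurable
  have "norm (indicator {0..h} t *\<^sub>R G t x) \<le> norm (indicator {0..h} t * (u (x + t *\<^sub>R v) + w x))" for t x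
    using bound[of t x] by (auto simp: indicator_def)
  then show "AE p in lborel \<Otimes>\<^sub>M lborel. norm (case p of (t, x) \<Rightarrow> indicator {0..h} t *\<^sub>R G t x)
      \<le> norm (case p of (t, x) \<Rightarrow> indicator {0..h} t * (u (x + t *\<^sub>R v) + w x))"
    by (intro AE_I2) auto
qed

lemma norm_mult_le_squares: "cmod (a * b) \<le> (cmod a)\<^sup>2 + (cmod b)\<^sup>2"
  using sum_squares_bound[of "cmod a" "cmod b"]
    zero_le_power2[of "cmod a"] zero_le_power2[of "cmod b"]
  unfolding norm_mult by linarith

text \<open>Expanding the nonnegative integral of (|w| - a/h)^2 over the interval, where a/h is the
  mean of |w|, gives a^2 \<le> h times the integral of |w|^2; the triangle inequality then replaces
  \<open>a\<close> by the norm of the integral.\<close>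

lemma cauchy_schwarz_interval:
  fixes w :: "real \<Rightarrow> complex"
  assumes [measurable]: "w \<in> borel_measurable lborel"
    and int: "integrable lborel (\<lambda>t. indicator {0..h} t * (cmod (w t))\<^sup>2)" and h: "0 < h"
  shows "(cmod (LINT t|lborel. indicator {0..h} t *\<^sub>R w t))\<^sup>2 \<le>
    h * (LINT t|lborel. indicator {0..h} t * (cmod (w t))\<^sup>2)"
proof -
  define a where "a = (LINT t|lborel. indicator {0..h} t * cmod (w t))"
  have i1: "integrable lborel (\<lambda>t. indicat_real {0..h} t)"
    by (rule integrable_real_indicator) (auto simp: emeasure_lborel_Icc_eq)
  have l1: "(LINT t|lborel. indicat_real {0..h} t) = h" using h by simp
  have "integrable lborel (\<lambda>t. indicator {0..h} t + indicator {0..h} t * (cmod (w t))\<^sup>2)"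
    using i1 int by simp
  then have i2: "integrable lborel (\<lambda>t. indicator {0..h} t * cmod (w t))"
  proof (rule Bochner_Integration.integrable_bound)
    have "r \<le> 1 + r\<^sup>2" for r :: real
      using self_le_power[of r 2] zero_le_power2[of r] by (cases "1 \<le> r") linarith+
    then show "AE t in lborel. norm (indicator {0..h} t * cmod (w t))
        \<le> norm (indicat_real {0..h} t + indicator {0..h} t * (cmod (w t))\<^sup>2)"
      by (intro AE_I2) (simp add: indicator_def)
  qed measurable
  have a: "cmod (LINT t|lborel. indicator {0..h} t *\<^sub>R w t) \<le> a"
    unfolding a_def using integral_norm_bound[of lborel "\<lambda>t. indicator {0..h} t *\<^sub>R w t"]
    by (simp add: indicator_def)
  have "0 \<le> (LINT t|lborel. indicator {0..h} t * (cmod (w t) - a / h)\<^sup>2)"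
    by (intro Bochner_Integration.integral_nonneg) auto
  also have "\<dots> = (LINT t|lborel. indicator {0..h} t * (cmod (w t))\<^sup>2
      - (2 * a / h) * (indicator {0..h} t * cmod (w t)) + (a / h)\<^sup>2 * indicator {0..h} t)"
    by (intro Bochner_Integration.integral_cong) (auto simp: power2_diff indicator_def algebra_simps)
  also have "\<dots> = (LINT t|lborel. indicator {0..h} t * (cmod (w t))\<^sup>2) - (2 * a / h) * a + (a / h)\<^sup>2 * h"
    using i1 i2 int by (simp add: a_def l1)
  also have "\<dots> = (LINT t|lborel. indicator {0..h} t * (cmod (w t))\<^sup>2) - a\<^sup>2 / h"
    using h by (simp add: power2_eq_square field_simps)
  finally have "a\<^sup>2 \<le> h * (LINT t|lborel. indicator {0..h} t * (cmod (w t))\<^sup>2)"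
    using h by (simp add: field_simps)
  then show ?thesis using power_mono[OF a, of 2] by simp
qed

text \<open>Borel representatives are assumed rather than Lebesgue measurable functions, so that
  \<open>D (x + t *\<^sub>R v)\<close> is jointly measurable in t and x for the product of the
  uncompleted measures.\<close>

locale weak_partial_derivative =
  fixes f D :: "real^'n \<Rightarrow> complex" and j :: 'n
  assumes f_meas [measurable]: "f \<in> borel_measurable borel"
    and D_meas [measurable]: "D \<in> borel_measurable borel"
    and f_int: "integrable lborel (\<lambda>x. (cmod (f x))\<^sup>2)"
    and D_int: "integrable lborel (\<lambda>x. (cmod (D x))\<^sup>2)"
    and weak: "\<And>\<psi>. \<psi> \<in> test_functions UNIV \<Longrightarrow>
      (LINT x|lborel. f x * partial j \<psi> x) = - (LINT x|lborel. D x * \<psi> x)"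
begin

abbreviation e :: "real^'n" where "e \<equiv> axis j 1"

definition line_integral :: "real \<Rightarrow> real^'n \<Rightarrow> complex" where
  "line_integral h x = (LINT t|lborel. indicator {0..h} t *\<^sub>R D (x + t *\<^sub>R e))"

lemma line_integral_meas [measurable]: "line_integral h \<in> borel_measurable borel"
  unfolding line_integral_def[abs_def] by measurable

text \<open>Cauchy-Schwarz in t for fixed x costs one factor h; Fubini and translation invariance
  turn the remaining double integral into h times the squared norm of \<open>D\<close>.\<close>

lemma line_integral_square:
  assumes h: "0 < h"
  shows "integrable lborel (\<lambda>x. (cmod (line_integral h x))\<^sup>2)"
    and "(LINT x|lborel. (cmod (line_integral h x))\<^sup>2) \<le> h\<^sup>2 * (LINT x|lborel. (cmod (D x))\<^sup>2)"
proof -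
  define u where "u x = (cmod (D x))\<^sup>2" for x
  have [measurable]: "u \<in> borel_measurable borel" unfolding u_def[abs_def] by measurable
  have u: "integrable lborel u" using D_int by (simp add: u_def[abs_def])
  note strip = integrable_strip[OF _ u, where h = h and v = e]
  have i: "integrable lborel (\<lambda>x. h * (LINT t|lborel. indicator {0..h} t * u (x + t *\<^sub>R e)))"
    using lborel_pair.integrable_snd[OF strip] by simp
  have ae: "AE x in lborel. (cmod (line_integral h x))\<^sup>2 \<le>
      h * (LINT t|lborel. indicator {0..h} t * u (x + t *\<^sub>R e))"
  proof -
    have "AE x in lborel. integrable lborel (\<lambda>t. indicator {0..h} t * u (x + t *\<^sub>R e))"
      using lborel_pair.AE_integrable_snd[OF strip] by simp
    then show ?thesis
      by eventually_elim (use cauchy_schwarz_interval[OF _ _ h] in \<open>auto simp: line_integral_def u_def\<close>)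
  qed
  show int: "integrable lborel (\<lambda>x. (cmod (line_integral h x))\<^sup>2)"
    by (rule Bochner_Integration.integrable_bound[OF i]) (use ae in \<open>auto elim: eventually_mono\<close>)
  have "(LINT x|lborel. (cmod (line_integral h x))\<^sup>2) \<le>
      (LINT x|lborel. h * (LINT t|lborel. indicator {0..h} t * u (x + t *\<^sub>R e)))"
    by (rule integral_mono_AE[OF int i ae])
  also have "\<dots> = h * (LINT t|lborel. LINT x|lborel. indicator {0..h} t * u (x + t *\<^sub>R e))"
    using lborel_pair.Fubini_integral[OF strip] by simp
  also have "\<dots> = h * (LINT t|lborel. indicator {0..h} t * (LINT x|lborel. u x))"
    by (simp add: lborel_integral_translate)
  also have "\<dots> = h\<^sup>2 * (LINT x|lborel. u x)"
    using h by (simp add: power2_eq_square)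
  finally show "(LINT x|lborel. (cmod (line_integral h x))\<^sup>2) \<le> h\<^sup>2 * (LINT x|lborel. (cmod (D x))\<^sup>2)"
    by (simp add: u_def)
qed

text \<open>Only test functions are differentiated classically. After pairing with \<psi>, the
  translation is moved from \<open>f\<close> to \<psi>, the fundamental theorem of calculus is
  applied to \<psi> along the line, the weak derivative passes to \<open>D\<close>, and the
  translation is moved back. Since both sides are in \<open>L2\<close>, equality of all pairings
  gives equality almost everywhere.\<close>

lemma difference_eq_line_integral:
  assumes h: "0 < h"
  shows "AE x in lborel. f (x + h *\<^sub>R e) - f x = line_integral h x"
proof -
  have L2I: "g \<in> L2" if "g \<in> borel_measurable borel" "integrable lborel (\<lambda>x. (cmod (g x))\<^sup>2)"
    for g :: "real^'n \<Rightarrow> complex"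
    using that by (simp add: L2_def measurable_completion integrable_completion)
  have LL: "(LINT x|lebesgue. g x) = (LINT x|lborel. g x)" if "g \<in> borel_measurable borel"
    for g :: "real^'n \<Rightarrow> complex"
    using that by (simp add: integral_completion)
  have fh: "integrable lborel (\<lambda>x. (cmod (f (x + h *\<^sub>R e)))\<^sup>2)"
    using f_int lborel_integral_translate(2)[of "\<lambda>x. (cmod (f x))\<^sup>2"] by simp
  have L2: "f \<in> L2" "D \<in> L2" "line_integral h \<in> L2" "(\<lambda>x. f (x + h *\<^sub>R e)) \<in> L2"
    using f_int D_int fh line_integral_square(1)[OF h] by (auto intro!: L2I)
  have int: "integrable lborel (\<lambda>x. a x * b x)"
    if "a \<in> L2" "b \<in> L2" "a \<in> borel_measurable borel" "b \<in> borel_measurable borel"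
    for a b :: "real^'n \<Rightarrow> complex"
    using L2_mult_integrable[OF that(1,2)] that(3,4) by (simp add: integrable_completion)
  have "AE x in lebesgue. f (x + h *\<^sub>R e) - f x - line_integral h x = 0"
  proof (rule fundamental_lemma_calculus_of_variations[where \<Omega> = UNIV])
    show "(\<lambda>x. f (x + h *\<^sub>R e) - f x - line_integral h x) \<in> L2"
      by (intro L2_diff L2)
  next
    fix \<psi> :: "real^'n \<Rightarrow> complex" assume t: "\<psi> \<in> test_functions UNIV"
    have [measurable]: "\<psi> \<in> borel_measurable borel" by (rule test_functions_measurable[OF t])
    have [measurable]: "partial j \<psi> \<in> borel_measurable borel"
      by (rule test_functions_measurable[OF test_functions_partial[OF t]])
    have square: "integrable lborel (\<lambda>x. (cmod (g x))\<^sup>2)" if "g \<in> test_functions UNIV"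
      for g :: "real^'n \<Rightarrow> complex"
      using L2_D(2)[OF test_functions_L2[OF that]] test_functions_measurable[OF that]
      by (simp add: integrable_completion)
    have smooth: "Ck k \<psi>" for k using t by (simp add: test_functions_def)
    have tL2: "\<psi> \<in> L2" "(\<lambda>x. \<psi> (x - h *\<^sub>R e)) \<in> L2"
      using test_functions_L2[OF t] test_functions_L2[OF test_functions_translate[OF t, of "- (h *\<^sub>R e)"]] by simp_all
    have FTC: "\<psi> (x - h *\<^sub>R e) - \<psi> x = - (LINT t|lborel. indicator {0..h} t *\<^sub>R partial j \<psi> (x - t *\<^sub>R e))" for x
    proof -
      have "((\<lambda>t. \<psi> (x - t *\<^sub>R e)) has_vector_derivative - partial j \<psi> (x - t *\<^sub>R e)) (at t within {0..h})" for t
      proof -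
        have l: "linear (frechet_derivative \<psi> (at y))" for y
          using smooth_has_derivative[OF smooth, of y] has_derivative_linear by blast
        have "((\<lambda>t. x - t *\<^sub>R e) has_derivative (\<lambda>s. - (s *\<^sub>R e))) (at t within {0..h})"
          by (auto intro!: derivative_eq_intros)
        from has_derivative_compose[OF this smooth_has_derivative[OF smooth]]
        show ?thesis
          unfolding has_vector_derivative_def partial_def
          by (simp add: linear_neg[OF l] linear_scale[OF l] scaleR_minus_right)
      qed
      moreover have "continuous_on {0..h} (\<lambda>t. - partial j \<psi> (x - t *\<^sub>R e))"
        by (intro continuous_on_minus continuous_on_compose2[OF test_functions_continuous[OF test_functions_partial[OF t]]]
            continuous_intros) auto
      ultimately have "(LINT t|lborel. indicator {0..h} t *\<^sub>R - partial j \<psi> (x - t *\<^sub>R e)) =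
          \<psi> (x - h *\<^sub>R e) - \<psi> (x - 0 *\<^sub>R e)"
        using h by (intro integral_FTC_atLeastAtMost) auto
      then show ?thesis by simp
    qed
    have strip1: "integrable (lborel \<Otimes>\<^sub>M lborel) (\<lambda>(t, x). indicator {0..h} t *\<^sub>R (f x * partial j \<psi> (x - t *\<^sub>R e)))"
      by (rule integrable_strip_bound[where v = "- e" and u = "\<lambda>x. (cmod (partial j \<psi> x))\<^sup>2" and w = "\<lambda>x. (cmod (f x))\<^sup>2"])
        (use f_int square[OF test_functions_partial[OF t]] norm_mult_le_squares in \<open>auto simp: add.commute\<close>)
    have strip2: "integrable (lborel \<Otimes>\<^sub>M lborel) (\<lambda>(t, x). indicator {0..h} t *\<^sub>R (D (x + t *\<^sub>R e) * \<psi> x))"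
      by (rule integrable_strip_bound[where v = e and u = "\<lambda>x. (cmod (D x))\<^sup>2" and w = "\<lambda>x. (cmod (\<psi> x))\<^sup>2"])
        (use D_int square[OF t] norm_mult_le_squares in auto)
    \<comment> \<open>Each translate of \<psi> is a test function, so the weak derivative can be
      used separately for every t before integrating over t.\<close>
    have weak_t: "(LINT x|lborel. f x * partial j \<psi> (x - t *\<^sub>R e)) = - (LINT x|lborel. D (x + t *\<^sub>R e) * \<psi> x)" for t
    proof -
      have "partial j (\<lambda>x. \<psi> (x + - (t *\<^sub>R e))) = (\<lambda>x. partial j \<psi> (x + - (t *\<^sub>R e)))"
        using smooth_differentiable[OF smooth]
        by (intro ext partial_translate(2)) (simp add: differentiable_on_def)
      then have "(LINT x|lborel. f x * partial j \<psi> (x - t *\<^sub>R e)) = - (LINT x|lborel. D x * \<psi> (x - t *\<^sub>R e))"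
        using weak[OF test_functions_translate[OF t, of "- (t *\<^sub>R e)"]] by simp
      also have "(LINT x|lborel. D x * \<psi> (x - t *\<^sub>R e)) = (LINT x|lborel. D (x + t *\<^sub>R e) * \<psi> x)"
        using lborel_integral_translate(1)[of "\<lambda>x. D x * \<psi> (x - t *\<^sub>R e)" "t *\<^sub>R e"] by simp
      finally show ?thesis .
    qed
    have "(LINT x|lborel. (f (x + h *\<^sub>R e) - f x) * \<psi> x) =
        (LINT x|lborel. f (x + h *\<^sub>R e) * \<psi> x) - (LINT x|lborel. f x * \<psi> x)"
      unfolding left_diff_distrib using L2 tL2 by (intro Bochner_Integration.integral_diff int) auto
    also have "(LINT x|lborel. f (x + h *\<^sub>R e) * \<psi> x) = (LINT x|lborel. f x * \<psi> (x - h *\<^sub>R e))"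
      using lborel_integral_translate(1)[of "\<lambda>x. f x * \<psi> (x - h *\<^sub>R e)" "h *\<^sub>R e"] by simp
    also have "\<dots> - (LINT x|lborel. f x * \<psi> x) = (LINT x|lborel. f x * (\<psi> (x - h *\<^sub>R e) - \<psi> x))"
      unfolding right_diff_distrib using L2 tL2
      by (intro Bochner_Integration.integral_diff[symmetric] int) auto
    also have "\<dots> = - (LINT x|lborel. LINT t|lborel. indicator {0..h} t *\<^sub>R (f x * partial j \<psi> (x - t *\<^sub>R e)))"
      unfolding FTC by (simp flip: mult_scaleR_right)
    also have "\<dots> = - (LINT t|lborel. LINT x|lborel. indicator {0..h} t *\<^sub>R (f x * partial j \<psi> (x - t *\<^sub>R e)))"
      using lborel_pair.Fubini_integral[OF strip1] by simp
    also have "\<dots> = (LINT t|lborel. LINT x|lborel. indicator {0..h} t *\<^sub>R (D (x + t *\<^sub>R e) * \<psi> x))"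
      by (simp add: weak_t)
    also have "\<dots> = (LINT x|lborel. LINT t|lborel. indicator {0..h} t *\<^sub>R (D (x + t *\<^sub>R e) * \<psi> x))"
      using lborel_pair.Fubini_integral[OF strip2] by simp
    also have "\<dots> = (LINT x|lborel. line_integral h x * \<psi> x)"
      unfolding line_integral_def by (simp flip: scaleR_left_commute add: integral_mult_left_zero[symmetric])
    finally have "(LINT x|lborel. (f (x + h *\<^sub>R e) - f x) * \<psi> x) = (LINT x|lborel. line_integral h x * \<psi> x)" .
    moreover have "(LINT x|lborel. (f (x + h *\<^sub>R e) - f x - line_integral h x) * \<psi> x) =
        (LINT x|lborel. (f (x + h *\<^sub>R e) - f x) * \<psi> x) - (LINT x|lborel. line_integral h x * \<psi> x)"
      unfolding left_diff_distrib[of "f _ - f _" "line_integral h _"]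
      using L2 tL2 by (intro Bochner_Integration.integral_diff int L2_diff) auto
    ultimately show "(LINT x|lebesgue. (f (x + h *\<^sub>R e) - f x - line_integral h x) * \<psi> x) = 0"
      by (subst LL) auto
  qed auto
  then show ?thesis by (simp add: AE_lebesgue_iff)
qed

end

subsection \<open>The product rule for \<open>\<bar>f\<bar>\<^sup>2\<close>\<close>

lemma square_integrable_mult:
  fixes a b :: "'a::euclidean_space \<Rightarrow> complex"
  assumes [measurable]: "a \<in> borel_measurable borel" "b \<in> borel_measurable borel"
    and "integrable lborel (\<lambda>x. (cmod (a x))\<^sup>2)" "integrable lborel (\<lambda>x. (cmod (b x))\<^sup>2)"
  shows "integrable lborel (\<lambda>x. a x * b x)"
proof (rule Bochner_Integration.integrable_bound)
  show "integrable lborel (\<lambda>x. (cmod (a x))\<^sup>2 + (cmod (b x))\<^sup>2)" using assms by simp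
  have "norm (a x * b x) \<le> norm ((cmod (a x))\<^sup>2 + (cmod (b x))\<^sup>2)" for x
    using norm_mult_le_squares[of "a x" "b x"] by simp
  then show "AE x in lborel. norm (a x * b x) \<le> norm ((cmod (a x))\<^sup>2 + (cmod (b x))\<^sup>2)" by simp
qed measurable

lemma weighted_young: "0 < t \<Longrightarrow> a * b \<le> a\<^sup>2 / (2 * t) + t * b\<^sup>2 / (2::real)"
  using zero_le_power2[of "a - t * b"] by (simp add: power2_eq_square field_simps)

text \<open>Global bounds on \<open>V\<close> and \<open>W\<close> take the place of a compact
  support. They supply the dominating functions and keep the remainders below of order h^2.\<close>

locale weak_product = weak_partial_derivative f D j
  for f D :: "real^'n \<Rightarrow> complex" and j :: 'n +
  fixes V W :: "real^'n \<Rightarrow> real" and M C :: real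
  assumes V_meas [measurable]: "V \<in> borel_measurable borel"
    and W_meas [measurable]: "W \<in> borel_measurable borel"
    and V_bound: "\<And>x. \<bar>V x\<bar> \<le> M"
    and W_bound: "\<And>x. \<bar>W x\<bar> \<le> C"
    and V_deriv: "\<And>x t. ((\<lambda>t. V (x + t *\<^sub>R axis j 1)) has_real_derivative W (x + t *\<^sub>R axis j 1)) (at t)"
begin

definition F_sq :: real where "F_sq = (LINT x|lborel. (cmod (f x))\<^sup>2)"
definition D_sq :: real where "D_sq = (LINT x|lborel. (cmod (D x))\<^sup>2)"
definition vf :: "real^'n \<Rightarrow> complex" where "vf x = complex_of_real (V x) * cnj (f x)"
definition pairing :: "real \<Rightarrow> complex" where "pairing t = (LINT x|lborel. vf x * D (x + t *\<^sub>R e))"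

lemma M_nonneg: "0 \<le> M" using V_bound[of 0] by linarith
lemma C_nonneg: "0 \<le> C" using W_bound[of 0] by linarith

lemma V_lipschitz: "\<bar>V (x + t *\<^sub>R e) - V x\<bar> \<le> C * \<bar>t\<bar>"
  using field_differentiable_bound[of UNIV "\<lambda>t. V (x + t *\<^sub>R e)" "\<lambda>t. W (x + t *\<^sub>R e)" C t 0]
    V_deriv W_bound by auto

lemma vf_meas [measurable]: "vf \<in> borel_measurable borel"
  unfolding vf_def[abs_def] by measurable

lemma vf_int: "integrable lborel (\<lambda>x. (cmod (vf x))\<^sup>2)"
proof (rule Bochner_Integration.integrable_bound)
  show "integrable lborel (\<lambda>x. M\<^sup>2 * (cmod (f x))\<^sup>2)" using f_int by simp
  have "(cmod (vf x))\<^sup>2 \<le> M\<^sup>2 * (cmod (f x))\<^sup>2" for x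
    using power_mono[OF V_bound[of x], of 2]
    by (simp add: vf_def norm_mult power_mult_distrib mult_right_mono)
  then show "AE x in lborel. norm ((cmod (vf x))\<^sup>2) \<le> norm (M\<^sup>2 * (cmod (f x))\<^sup>2)" by simp
qed measurable

lemma f_translate_int: "integrable lborel (\<lambda>x. (cmod (f (x + c)))\<^sup>2)"
  using f_int lborel_integral_translate(2)[of "\<lambda>x. (cmod (f x))\<^sup>2"] by simp

lemma difference_square:
  assumes "0 < h"
  shows "integrable lborel (\<lambda>x. (cmod (f (x - h *\<^sub>R e) - f x))\<^sup>2)"
    and "(LINT x|lborel. (cmod (f (x - h *\<^sub>R e) - f x))\<^sup>2) \<le> h\<^sup>2 * D_sq"
proof -
  have ae: "AE x in lborel. (cmod (line_integral h x))\<^sup>2 = (cmod (f x - f (x + h *\<^sub>R e)))\<^sup>2"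
    using difference_eq_line_integral[OF assms] by eventually_elim (metis norm_minus_commute)
  have "integrable lborel (\<lambda>x. (cmod (f x - f (x + h *\<^sub>R e)))\<^sup>2)"
    using line_integral_square(1)[OF assms] integrable_cong_AE[OF _ _ ae] by simp
  then show "integrable lborel (\<lambda>x. (cmod (f (x - h *\<^sub>R e) - f x))\<^sup>2)"
    using lborel_integral_translate(2)[of "\<lambda>x. (cmod (f (x - h *\<^sub>R e) - f x))\<^sup>2" "h *\<^sub>R e"] by simp
  have "(LINT x|lborel. (cmod (f (x - h *\<^sub>R e) - f x))\<^sup>2) = (LINT x|lborel. (cmod (f x - f (x + h *\<^sub>R e)))\<^sup>2)"
    using lborel_integral_translate(1)[of "\<lambda>x. (cmod (f (x - h *\<^sub>R e) - f x))\<^sup>2" "h *\<^sub>R e"] by simp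
  also have "\<dots> = (LINT x|lborel. (cmod (line_integral h x))\<^sup>2)"
    by (rule integral_cong_AE[OF _ _ ae, symmetric]) simp_all
  also have "\<dots> \<le> h\<^sup>2 * D_sq" using line_integral_square(2)[OF assms] by (simp add: D_sq_def)
  finally show "(LINT x|lborel. (cmod (f (x - h *\<^sub>R e) - f x))\<^sup>2) \<le> h\<^sup>2 * D_sq" .
qed

text \<open>The translation is moved from \<open>D\<close> to \<open>vf\<close>, where it can be
  estimated: the difference of \<open>vf\<close> consists of a difference of \<open>f\<close>, of
  norm at most t times that of \<open>D\<close>, and a difference of \<open>V\<close>, at most C t.
  Young's inequality is weighted with t itself, which makes both of its terms linear in t.\<close>

lemma pairing_lipschitz:
  assumes "0 \<le> t"
  shows "cmod (pairing t - pairing 0) \<le> (M * D_sq + C * (F_sq + D_sq)) * t"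
proof (cases "t = 0")
  case False
  with assms have t: "0 < t" by simp
  have i: "integrable lborel (\<lambda>x. vf (x - t *\<^sub>R e) * D x)" "integrable lborel (\<lambda>x. vf x * D x)"
    using vf_int D_int lborel_integral_translate(2)[of "\<lambda>x. (cmod (vf x))\<^sup>2" "- (t *\<^sub>R e)"]
    by (auto intro!: square_integrable_mult)
  have "pairing t = (LINT x|lborel. vf (x - t *\<^sub>R e) * D x)"
    using lborel_integral_translate(1)[of "\<lambda>x. vf (x - t *\<^sub>R e) * D x" "t *\<^sub>R e"] by (simp add: pairing_def)
  then have "cmod (pairing t - pairing 0) = cmod (LINT x|lborel. vf (x - t *\<^sub>R e) * D x - vf x * D x)"
    using i by (simp add: pairing_def)
  also have "\<dots> \<le> (LINT x|lborel. M * ((cmod (f (x - t *\<^sub>R e) - f x))\<^sup>2 / (2 * t) + t * (cmod (D x))\<^sup>2 / 2)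
      + C * t * ((cmod (f x))\<^sup>2 + (cmod (D x))\<^sup>2))"
  proof (rule Bochner_Integration.integral_norm_bound_integral)
    show "integrable lborel (\<lambda>x. vf (x - t *\<^sub>R e) * D x - vf x * D x)" using i by simp
    show "integrable lborel (\<lambda>x. M * ((cmod (f (x - t *\<^sub>R e) - f x))\<^sup>2 / (2 * t) + t * (cmod (D x))\<^sup>2 / 2)
      + C * t * ((cmod (f x))\<^sup>2 + (cmod (D x))\<^sup>2))"
      using difference_square(1)[OF t] f_int D_int by simp
  next
    fix x
    define y where "y = x - t *\<^sub>R e"
    have eq: "vf y * D x - vf x * D x = of_real (V y) * (cnj (f y) - cnj (f x)) * D x + of_real (V y - V x) * cnj (f x) * D x"
      by (simp add: vf_def algebra_simps)
    have V: "\<bar>V y - V x\<bar> \<le> C * t"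
      using V_lipschitz[of x "- t"] t by (simp add: y_def)
    have "cmod (vf y * D x - vf x * D x) \<le> \<bar>V y\<bar> * (cmod (f y - f x) * cmod (D x)) + \<bar>V y - V x\<bar> * (cmod (f x) * cmod (D x))"
      unfolding eq by (rule order_trans[OF norm_triangle_ineq])
        (simp add: norm_mult flip: complex_cnj_diff of_real_diff)
    also have "\<dots> \<le> M * ((cmod (f y - f x))\<^sup>2 / (2 * t) + t * (cmod (D x))\<^sup>2 / 2) + C * t * ((cmod (f x))\<^sup>2 + (cmod (D x))\<^sup>2)"
      using norm_mult_le_squares[of "f x" "D x"]
      by (intro add_mono mult_mono V_bound V weighted_young t) (auto simp: norm_mult M_nonneg C_nonneg assms)
    finally show "cmod (vf (x - t *\<^sub>R e) * D x - vf x * D x) \<le>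
        M * ((cmod (f (x - t *\<^sub>R e) - f x))\<^sup>2 / (2 * t) + t * (cmod (D x))\<^sup>2 / 2) + C * t * ((cmod (f x))\<^sup>2 + (cmod (D x))\<^sup>2)"
      by (simp add: y_def)
  qed
  also have "\<dots> = M * ((LINT x|lborel. (cmod (f (x - t *\<^sub>R e) - f x))\<^sup>2) / (2 * t) + t * D_sq / 2) + C * t * (F_sq + D_sq)"
  proof -
    have "(LINT x|lborel. M * (a x / (2 * t) + t * b x / 2) + C * t * (c x + b x)) =
        M * ((LINT x|lborel. a x) / (2 * t) + t * (LINT x|lborel. b x) / 2)
          + C * t * ((LINT x|lborel. c x) + (LINT x|lborel. b x))"
      if "integrable lborel a" "integrable lborel b" "integrable lborel c" for a b c :: "real^'n \<Rightarrow> real"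
      using that by (simp del: distrib_left distrib_right)
    from this[OF difference_square(1)[OF t] D_int f_int] show ?thesis
      by (simp only: F_sq_def D_sq_def)
  qed
  also have "\<dots> \<le> M * (t\<^sup>2 * D_sq / (2 * t) + t * D_sq / 2) + C * t * (F_sq + D_sq)"
    using difference_square(2)[OF t] t by (intro add_right_mono mult_left_mono divide_right_mono M_nonneg) auto
  also have "\<dots> = (M * D_sq + C * (F_sq + D_sq)) * t"
    using t by (simp add: power2_eq_square field_simps)
  finally show ?thesis .
qed simp

text \<open>By Fubini the left integral is that of \<open>pairing t\<close> over t from 0 to h, and
  on this interval \<open>pairing t\<close> stays within K h of \<open>pairing 0\<close>.\<close>

lemma pairing_line_integral:
  assumes h: "0 < h"
  shows "cmod ((LINT x|lborel. vf x * line_integral h x) - h * pairing 0) \<le> (M * D_sq + C * (F_sq + D_sq)) * h\<^sup>2"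
proof -
  let ?K = "M * D_sq + C * (F_sq + D_sq)"
  have K: "0 \<le> ?K" using M_nonneg C_nonneg by (simp add: F_sq_def D_sq_def)
  have strip: "integrable (lborel \<Otimes>\<^sub>M lborel) (\<lambda>(t, x). indicator {0..h} t *\<^sub>R (vf x * D (x + t *\<^sub>R e)))"
    by (rule integrable_strip_bound[where v = e and u = "\<lambda>x. (cmod (D x))\<^sup>2" and w = "\<lambda>x. (cmod (vf x))\<^sup>2"])
      (use D_int vf_int norm_mult_le_squares in \<open>auto simp: add.commute\<close>)
  have "(LINT x|lborel. vf x * line_integral h x) =
      (LINT x|lborel. LINT t|lborel. indicator {0..h} t *\<^sub>R (vf x * D (x + t *\<^sub>R e)))"
    unfolding line_integral_def by (simp flip: mult_scaleR_right)
  also have "\<dots> = (LINT t|lborel. LINT x|lborel. indicator {0..h} t *\<^sub>R (vf x * D (x + t *\<^sub>R e)))"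
    using lborel_pair.Fubini_integral[OF strip] by simp
  also have "\<dots> = (LINT t|lborel. indicator {0..h} t *\<^sub>R pairing t)"
    by (simp add: pairing_def)
  finally have 1: "(LINT x|lborel. vf x * line_integral h x) = (LINT t|lborel. indicator {0..h} t *\<^sub>R pairing t)" .
  have i1: "integrable lborel (\<lambda>t. indicator {0..h} t *\<^sub>R pairing t)"
    using lborel_pair.integrable_fst[OF strip] by (simp add: pairing_def)
  have i2: "integrable lborel (\<lambda>t. indicat_real {0..h} t)"
    by (rule integrable_real_indicator) (auto simp: emeasure_lborel_Icc_eq)
  then have i3: "integrable lborel (\<lambda>t. indicat_real {0..h} t *\<^sub>R pairing 0)" by simp
  have "h * pairing 0 = (LINT t|lborel. indicator {0..h} t *\<^sub>R pairing 0)"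
    using h by (simp add: scaleR_conv_of_real)
  then have "cmod ((LINT x|lborel. vf x * line_integral h x) - h * pairing 0) =
      cmod (LINT t|lborel. indicator {0..h} t *\<^sub>R pairing t - indicator {0..h} t *\<^sub>R pairing 0)"
    unfolding 1 using i1 i3 by simp
  also have "\<dots> \<le> (LINT t|lborel. indicator {0..h} t * (?K * h))"
  proof (rule Bochner_Integration.integral_norm_bound_integral)
    show "integrable lborel (\<lambda>t. indicat_real {0..h} t * (?K * h))" using i2 by simp
    show "integrable lborel (\<lambda>t. indicator {0..h} t *\<^sub>R pairing t - indicator {0..h} t *\<^sub>R pairing 0)"
      using i1 i3 by simp
    fix t :: real
    show "norm (indicator {0..h} t *\<^sub>R pairing t - indicator {0..h} t *\<^sub>R pairing 0) \<le> indicator {0..h} t * (?K * h)"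
    proof (cases "t \<in> {0..h}")
      case True
      then have "cmod (pairing t - pairing 0) \<le> ?K * t" using pairing_lipschitz by simp
      also have "\<dots> \<le> ?K * h" using True K by (intro mult_left_mono) auto
      finally show ?thesis using True by simp
    qed simp
  qed
  also have "\<dots> = ?K * h\<^sup>2"
  proof -
    have c: "(LINT t|lborel. indicator {0..h} t * c) = h * c" for c using h by simp
    show ?thesis unfolding c by (simp only: power2_eq_square mult_ac)
  qed
  finally show ?thesis .
qed

text \<open>A discrete product rule. Translation turns V(x - h e) |f(x)|^2 into V(x) |f(x + h e)|^2,
  and with L = \<open>line_integral h x\<close> one has |f + L|^2 - |f|^2 = 2 Re (cnj f L) + |L|^2.
  The cross term is h \<open>pairing 0\<close> up to order h^2, and the quadratic term contributes
  at most M \<open>D_sq\<close> h^2.\<close>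

lemma difference_quotient_bound:
  assumes h: "0 < h"
  shows "\<bar>(LINT x|lborel. (cmod (f x))\<^sup>2 * ((V (x - h *\<^sub>R e) - V x) / h)) - 2 * Re (pairing 0)\<bar>
    \<le> (2 * (M * D_sq + C * (F_sq + D_sq)) + M * D_sq) * h"
proof -
  let ?K = "M * D_sq + C * (F_sq + D_sq)"
  let ?I = "LINT x|lborel. vf x * line_integral h x"
  let ?R = "LINT x|lborel. V x * (cmod (line_integral h x))\<^sup>2"
  note li = line_integral_square[OF h]
  have Vint: "integrable lborel (\<lambda>x. V (x + c) * u x)" if "integrable lborel u" for u c
    using that by (rule Bochner_Integration.integrable_bound[OF integrable_mult_right[of M]])
      (use that V_bound M_nonneg in \<open>auto intro!: AE_I2 mult_right_mono simp: abs_mult borel_measurable_integrable\<close>)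
  have i: "integrable lborel (\<lambda>x. V x * (cmod (f x))\<^sup>2)" "integrable lborel (\<lambda>x. V (x - h *\<^sub>R e) * (cmod (f x))\<^sup>2)"
    "integrable lborel (\<lambda>x. V x * (cmod (f (x + h *\<^sub>R e)))\<^sup>2)"
    "integrable lborel (\<lambda>x. V x * (cmod (line_integral h x))\<^sup>2)"
    using Vint[OF f_int, of 0] Vint[OF f_int, of "- (h *\<^sub>R e)"] Vint[OF f_translate_int, of 0] Vint[OF li(1), of 0]
    by simp_all
  have i5: "integrable lborel (\<lambda>x. vf x * line_integral h x)"
    by (rule square_integrable_mult) (use vf_int li(1) in auto)
  have ae: "AE x in lborel. V x * (cmod (f (x + h *\<^sub>R e)))\<^sup>2 - V x * (cmod (f x))\<^sup>2 =
      2 * Re (vf x * line_integral h x) + V x * (cmod (line_integral h x))\<^sup>2"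
    using difference_eq_line_integral[OF h]
  proof eventually_elim
    case (elim x)
    then have "f (x + h *\<^sub>R e) = f x + line_integral h x" by (simp add: algebra_simps)
    then show ?case
      unfolding vf_def cmod_power2 by (simp add: power2_eq_square algebra_simps)
  qed
  have "h * (LINT x|lborel. (cmod (f x))\<^sup>2 * ((V (x - h *\<^sub>R e) - V x) / h)) =
      (LINT x|lborel. h * ((cmod (f x))\<^sup>2 * ((V (x - h *\<^sub>R e) - V x) / h)))" by simp
  also have "\<dots> = (LINT x|lborel. V (x - h *\<^sub>R e) * (cmod (f x))\<^sup>2 - V x * (cmod (f x))\<^sup>2)"
    using h by (intro Bochner_Integration.integral_cong) (auto simp: field_simps)
  also have "\<dots> = (LINT x|lborel. V (x - h *\<^sub>R e) * (cmod (f x))\<^sup>2) - (LINT x|lborel. V x * (cmod (f x))\<^sup>2)"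
    using i by simp
  also have "(LINT x|lborel. V (x - h *\<^sub>R e) * (cmod (f x))\<^sup>2) = (LINT x|lborel. V x * (cmod (f (x + h *\<^sub>R e)))\<^sup>2)"
    using lborel_integral_translate(1)[of "\<lambda>x. V (x - h *\<^sub>R e) * (cmod (f x))\<^sup>2" "h *\<^sub>R e"] by simp
  also have "\<dots> - (LINT x|lborel. V x * (cmod (f x))\<^sup>2) =
      (LINT x|lborel. V x * (cmod (f (x + h *\<^sub>R e)))\<^sup>2 - V x * (cmod (f x))\<^sup>2)" using i by simp
  also have "\<dots> = (LINT x|lborel. 2 * Re (vf x * line_integral h x) + V x * (cmod (line_integral h x))\<^sup>2)"
    by (rule integral_cong_AE[OF _ _ ae]) simp_all
  also have "\<dots> = 2 * Re ?I + ?R" using i i5 by (simp del: times_complex.sel)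
  finally have eq: "h * (LINT x|lborel. (cmod (f x))\<^sup>2 * ((V (x - h *\<^sub>R e) - V x) / h)) = 2 * Re ?I + ?R" .
  have R: "\<bar>?R\<bar> \<le> M * D_sq * h\<^sup>2"
  proof -
    have "\<bar>?R\<bar> \<le> (LINT x|lborel. M * (cmod (line_integral h x))\<^sup>2)"
      using Bochner_Integration.integral_norm_bound_integral[OF i(4), of "\<lambda>x. M * (cmod (line_integral h x))\<^sup>2"] li(1) V_bound
      by (simp add: abs_mult mult_right_mono)
    also have "\<dots> \<le> M * (h\<^sup>2 * D_sq)" using li(2) M_nonneg by (simp add: D_sq_def mult_left_mono)
    finally show ?thesis by (simp add: algebra_simps)
  qed
  have I: "\<bar>Re ?I - h * Re (pairing 0)\<bar> \<le> ?K * h\<^sup>2"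
    using pairing_line_integral[OF h] abs_Re_le_cmod[of "?I - h * pairing 0"] by simp
  let ?Q = "LINT x|lborel. (cmod (f x))\<^sup>2 * ((V (x - h *\<^sub>R e) - V x) / h)"
  have "h * \<bar>?Q - 2 * Re (pairing 0)\<bar> = \<bar>h * ?Q - 2 * (h * Re (pairing 0))\<bar>"
    using h by (simp add: abs_mult_pos' right_diff_distrib mult.left_commute)
  also have "\<dots> = \<bar>2 * (Re ?I - h * Re (pairing 0)) + ?R\<bar>"
    unfolding eq by (simp add: algebra_simps)
  also have "\<dots> \<le> 2 * (?K * h\<^sup>2) + M * D_sq * h\<^sup>2"
  proof -
    have "\<bar>2 * a + r\<bar> \<le> 2 * k + m" if "\<bar>a\<bar> \<le> k" "\<bar>r\<bar> \<le> m" for a r k m :: real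
      using that by linarith
    from this[OF I R] show ?thesis .
  qed
  also have "\<dots> = h * ((2 * ?K + M * D_sq) * h)" by (simp add: power2_eq_square algebra_simps)
  finally show ?thesis using h by simp
qed

text \<open>The limit h \<rightarrow> 0 of the discrete rule. The difference quotient of
  \<open>V\<close> is taken backwards, so it tends to \<open>- W\<close>; the Lipschitz bound on
  \<open>V\<close> dominates it by C |f|^2.\<close>

lemma product_rule:
  "(LINT x|lborel. (cmod (f x))\<^sup>2 * W x) = - 2 * Re (LINT x|lborel. vf x * D x)"
proof -
  define h where "h k = inverse (real (Suc k))" for k
  have h: "0 < h k" for k by (simp add: h_def)
  have h0: "h \<longlonglongrightarrow> 0" unfolding h_def by (rule LIMSEQ_inverse_real_of_nat)
  let ?Q = "\<lambda>k. LINT x|lborel. (cmod (f x))\<^sup>2 * ((V (x - h k *\<^sub>R e) - V x) / h k)"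
  have "?Q \<longlonglongrightarrow> (LINT x|lborel. (cmod (f x))\<^sup>2 * (- W x))"
  proof (rule integral_dominated_convergence)
    show "integrable lborel (\<lambda>x. C * (cmod (f x))\<^sup>2)" using f_int by simp
    have q: "\<bar>V (x - h k *\<^sub>R e) - V x\<bar> / h k \<le> C" for x k
      using V_lipschitz[of x "- h k"] h[of k] by (simp add: field_simps)
    show "AE x in lborel. norm ((cmod (f x))\<^sup>2 * ((V (x - h k *\<^sub>R e) - V x) / h k)) \<le> C * (cmod (f x))\<^sup>2" for k
      using mult_left_mono[OF q, of "(cmod (f _))\<^sup>2"] h[of k]
      by (intro AE_I2) (simp add: abs_mult mult.commute[of C])
    show "AE x in lborel. (\<lambda>k. (cmod (f x))\<^sup>2 * ((V (x - h k *\<^sub>R e) - V x) / h k)) \<longlonglongrightarrow> (cmod (f x))\<^sup>2 * (- W x)"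
    proof (intro AE_I2 tendsto_mult tendsto_const)
      fix x
      have "((\<lambda>s. (V (x + s *\<^sub>R e) - V x) / s) \<longlongrightarrow> W x) (at 0)"
        using V_deriv[of x 0] by (simp add: has_field_derivative_iff)
      moreover have "filterlim (\<lambda>k. - h k) (at 0) sequentially"
        using tendsto_minus[OF h0] h by (auto simp: filterlim_at less_imp_neq[symmetric])
      ultimately have "(\<lambda>k. (V (x + (- h k) *\<^sub>R e) - V x) / (- h k)) \<longlonglongrightarrow> W x"
        by (rule filterlim_compose)
      from tendsto_minus[OF this] show "(\<lambda>k. (V (x - h k *\<^sub>R e) - V x) / h k) \<longlonglongrightarrow> - W x" by simp
    qed
  qed measurable
  moreover have "?Q \<longlonglongrightarrow> 2 * Re (pairing 0)"
  proof (rule LIM_zero_cancel, rule tendsto_rabs_zero_cancel, rule tendsto_sandwich[OF _ _ tendsto_const])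
    let ?L = "2 * (M * D_sq + C * (F_sq + D_sq)) + M * D_sq"
    show "\<forall>\<^sub>F k in sequentially. \<bar>?Q k - 2 * Re (pairing 0)\<bar> \<le> ?L * h k"
      using difference_quotient_bound[OF h] by simp
    show "(\<lambda>k. ?L * h k) \<longlonglongrightarrow> 0" using tendsto_mult[OF tendsto_const[of ?L] h0] by simp
  qed simp
  ultimately have "(LINT x|lborel. (cmod (f x))\<^sup>2 * (- W x)) = 2 * Re (pairing 0)"
    by (rule LIMSEQ_unique)
  then show ?thesis by (simp add: pairing_def)
qed

end

subsection \<open>Hardy's inequality\<close>

text \<open>
  The vector field \<open>x / (\<bar>x\<bar>\<^sup>2 + \<epsilon>)\<close> is bounded with bounded derivatives, so that no
  cutoff at the origin or at infinity is needed in Hardy's inequality.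
\<close>

definition hardy_field :: "real \<Rightarrow> 'n \<Rightarrow> real^'n \<Rightarrow> real" where
  "hardy_field \<epsilon> j x = x $ j / (x \<bullet> x + \<epsilon>)"

definition hardy_field_deriv :: "real \<Rightarrow> 'n \<Rightarrow> real^'n \<Rightarrow> real" where
  "hardy_field_deriv \<epsilon> j x = 1 / (x \<bullet> x + \<epsilon>) - 2 * (x $ j)\<^sup>2 / (x \<bullet> x + \<epsilon>)\<^sup>2"

lemma inner_self_plus_pos: "0 < \<epsilon> \<Longrightarrow> 0 < (x::'a::real_inner) \<bullet> x + \<epsilon>"
  by (simp add: add_nonneg_pos)

lemma double_div_square: "0 < s \<Longrightarrow> 2 * s / s\<^sup>2 = 2 / (s::real)"
  by (simp add: power2_eq_square)

text \<open>The bound 1/\<epsilon> amounts to |x_j| \<epsilon> \<le> x \<bullet> x + \<epsilon>: for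
  |x_j| \<le> 1 the summand \<epsilon> suffices, and otherwise \<epsilon> \<le> 1 < |x_j| gives
  |x_j| \<epsilon> \<le> x_j^2. The bound 3/\<epsilon> adds 1/\<epsilon> and 2/\<epsilon> for the
  two terms of the derivative.\<close>

lemma weak_product_hardy_field:
  fixes f D :: "real^'n \<Rightarrow> complex"
  assumes w: "weak_partial_derivative f D j" and eps: "0 < \<epsilon>" "\<epsilon> \<le> 1"
  shows "weak_product f D j (hardy_field \<epsilon> j) (hardy_field_deriv \<epsilon> j) (1 / \<epsilon>) (3 / \<epsilon>)"
proof -
  have pos: "0 < x \<bullet> x + \<epsilon>" for x :: "real^'n" using eps(1) by (rule inner_self_plus_pos)
  have coord: "(x $ j)\<^sup>2 \<le> x \<bullet> x" for x :: "real^'n"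
    using power_mono[OF component_le_norm_cart[of x j], of 2] by (simp add: power2_norm_eq_inner)
  interpret weak_partial_derivative f D j by (rule w)
  show ?thesis
  proof unfold_locales
    show "hardy_field \<epsilon> j \<in> borel_measurable borel"
      unfolding hardy_field_def[abs_def] using pos
      by (intro borel_measurable_continuous_onI continuous_intros) (auto simp: less_imp_neq[symmetric])
    show "hardy_field_deriv \<epsilon> j \<in> borel_measurable borel"
      unfolding hardy_field_deriv_def[abs_def] using pos
      by (intro borel_measurable_continuous_onI continuous_intros) (auto simp: less_imp_neq[symmetric])
  next
    fix x :: "real^'n"
    have "\<bar>x $ j\<bar> * \<epsilon> \<le> x \<bullet> x + \<epsilon>"
    proof (cases "\<bar>x $ j\<bar> \<le> 1")
      case True
      then have "\<bar>x $ j\<bar> * \<epsilon> \<le> 1 * \<epsilon>" using eps by (intro mult_right_mono) auto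
      then show ?thesis using inner_ge_zero[of x] by linarith
    next
      case False
      then have "\<bar>x $ j\<bar> * \<epsilon> \<le> \<bar>x $ j\<bar> * \<bar>x $ j\<bar>" using eps by (intro mult_left_mono) auto
      then show ?thesis using coord[of x] eps by (simp add: power2_eq_square)
    qed
    then show "\<bar>hardy_field \<epsilon> j x\<bar> \<le> 1 / \<epsilon>"
      using pos[of x] eps by (simp add: hardy_field_def field_simps)
    have "1 / (x \<bullet> x + \<epsilon>) \<le> 1 / \<epsilon>" using eps pos[of x] by (intro divide_left_mono) auto
    moreover have "2 * (x $ j)\<^sup>2 / (x \<bullet> x + \<epsilon>)\<^sup>2 \<le> 2 * (x \<bullet> x + \<epsilon>) / (x \<bullet> x + \<epsilon>)\<^sup>2"
      using coord[of x] eps by (intro divide_right_mono) auto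
    moreover have "2 * (x \<bullet> x + \<epsilon>) / (x \<bullet> x + \<epsilon>)\<^sup>2 = 2 * (1 / (x \<bullet> x + \<epsilon>))"
      using double_div_square[OF pos[of x]] by simp
    moreover have "0 \<le> 1 / (x \<bullet> x + \<epsilon>)" "0 \<le> 2 * (x $ j)\<^sup>2 / (x \<bullet> x + \<epsilon>)\<^sup>2"
      using pos[of x] by auto
    ultimately show "\<bar>hardy_field_deriv \<epsilon> j x\<bar> \<le> 3 / \<epsilon>"
      unfolding hardy_field_deriv_def by linarith
  next
    fix x :: "real^'n" and t :: real
    have c: "(x + t *\<^sub>R axis j 1) $ j = x $ j + t" for t by (simp add: axis_def)
    have q: "(x + t *\<^sub>R axis j 1) \<bullet> (x + t *\<^sub>R axis j 1) = x \<bullet> x + 2 * t * x $ j + t\<^sup>2" for t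
      by (simp add: inner_add_left inner_add_right inner_axis inner_axis' axis_nth power2_eq_square algebra_simps)
    define Q where "Q = x \<bullet> x + 2 * t * x $ j + t\<^sup>2 + \<epsilon>"
    have Q: "Q > 0" using pos[of "x + t *\<^sub>R axis j 1"] unfolding q Q_def .
    have "((\<lambda>t. (x $ j + t) / (x \<bullet> x + 2 * t * x $ j + t\<^sup>2 + \<epsilon>)) has_real_derivative
        (1 * Q - (x $ j + t) * (2 * x $ j + 2 * t)) / (Q * Q)) (at t)"
      using Q unfolding Q_def by (auto intro!: derivative_eq_intros)
    moreover have "(1 * Q - (x $ j + t) * (2 * x $ j + 2 * t)) / (Q * Q) = 1 / Q - 2 * (x $ j + t)\<^sup>2 / Q\<^sup>2"
      using Q by (simp add: field_simps power2_eq_square)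
    ultimately show "((\<lambda>t. hardy_field \<epsilon> j (x + t *\<^sub>R axis j 1)) has_real_derivative
        hardy_field_deriv \<epsilon> j (x + t *\<^sub>R axis j 1)) (at t)"
      unfolding hardy_field_def hardy_field_deriv_def q c Q_def by simp
  qed
qed

lemma hardy_field_deriv_sum:
  fixes x :: "real^'n"
  shows "(\<Sum>j\<in>UNIV. hardy_field_deriv \<epsilon> j x) = real CARD('n) / (x \<bullet> x + \<epsilon>) - 2 * (x \<bullet> x) / (x \<bullet> x + \<epsilon>)\<^sup>2"
proof -
  have "(\<Sum>j\<in>UNIV. 2 * (x $ j)\<^sup>2 / (x \<bullet> x + \<epsilon>)\<^sup>2) = 2 * (x \<bullet> x) / (x \<bullet> x + \<epsilon>)\<^sup>2"
    unfolding inner_vec_def by (simp add: power2_eq_square sum_distrib_left sum_divide_distrib)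
  then show ?thesis by (simp add: hardy_field_deriv_def sum_subtractf)
qed

lemma unit_radial_meas [measurable]:
  fixes j :: "'n::finite"
  shows "unit_radial j \<in> borel_measurable borel"
proof -
  have "(\<lambda>x::real^'n. x $ j) \<in> borel_measurable borel"
    by (intro borel_measurable_continuous_onI continuous_intros)
  then show ?thesis unfolding unit_radial_def[abs_def] by measurable
qed

locale weak_gradient =
  fixes f :: "real^'n \<Rightarrow> complex" and D :: "'n \<Rightarrow> real^'n \<Rightarrow> complex"
  assumes weak_partial: "\<And>j. weak_partial_derivative f (D j) j"
begin

definition radial :: "real^'n \<Rightarrow> complex" where
  "radial x = (\<Sum>j\<in>UNIV. unit_radial j x * D j x)"

lemma f_meas [measurable]: "f \<in> borel_measurable borel"
  using weak_partial_derivative.f_meas[OF weak_partial] .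

lemma D_meas [measurable]: "D j \<in> borel_measurable borel"
  using weak_partial_derivative.D_meas[OF weak_partial] .

lemma f_int: "integrable lborel (\<lambda>x. (cmod (f x))\<^sup>2)"
  using weak_partial_derivative.f_int[OF weak_partial] .

lemma radial_meas [measurable]: "radial \<in> borel_measurable borel"
  unfolding radial_def[abs_def] by measurable

lemma radial_int: "integrable lborel (\<lambda>x. (cmod (radial x))\<^sup>2)"
proof (rule Bochner_Integration.integrable_bound)
  show "integrable lborel (\<lambda>x. real CARD('n) * (\<Sum>j\<in>UNIV. (cmod (D j x))\<^sup>2))"
    using weak_partial_derivative.D_int[OF weak_partial] by simp
  have "(cmod (radial x))\<^sup>2 \<le> real CARD('n) * (\<Sum>j\<in>UNIV. (cmod (D j x))\<^sup>2)" for x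
  proof -
    have u: "cmod (unit_radial j x) \<le> 1" for j
      using component_le_norm_cart[of x j] by (auto simp: unit_radial_def divide_le_eq_1 norm_divide)
    have "cmod (radial x) \<le> (\<Sum>j\<in>UNIV. cmod (D j x))"
      unfolding radial_def
      by (rule sum_norm_le) (use mult_right_mono[OF u] in \<open>simp add: norm_mult\<close>)
    then have "(cmod (radial x))\<^sup>2 \<le> (\<Sum>j\<in>UNIV. cmod (D j x))\<^sup>2"
      by (intro power_mono) auto
    also have "\<dots> \<le> real CARD('n) * (\<Sum>j\<in>UNIV. (cmod (D j x))\<^sup>2)"
      using sum_squared_le_sum_of_squares[of "\<lambda>j. cmod (D j x)" UNIV] by (simp add: mult.commute)
    finally show ?thesis .
  qed
  then show "AE x in lborel. norm ((cmod (radial x))\<^sup>2) \<le> norm (real CARD('n) * (\<Sum>j\<in>UNIV. (cmod (D j x))\<^sup>2))"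
    by (intro AE_I2) (simp add: order_trans[OF _ abs_ge_self])
qed measurable

lemma quotient_int:
  assumes "0 < \<epsilon>"
  shows "integrable lborel (\<lambda>x. (cmod (f x))\<^sup>2 / (x \<bullet> x + \<epsilon>))"
proof (rule Bochner_Integration.integrable_bound)
  show "integrable lborel (\<lambda>x. (cmod (f x))\<^sup>2 / \<epsilon>)" using f_int by simp
  show "AE x in lborel. norm ((cmod (f x))\<^sup>2 / (x \<bullet> x + \<epsilon>)) \<le> norm ((cmod (f x))\<^sup>2 / \<epsilon>)"
    using assms by (intro AE_I2) (auto intro!: divide_left_mono simp: abs_of_nonneg inner_self_plus_pos add_nonneg_nonneg)
qed measurable

text \<open>The product rules for all coordinates are added. Since the field is radial, the sum of
  its components times the weak derivatives is |x| / (x \<bullet> x + \<epsilon>) times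
  \<open>radial\<close>; at the origin both vanish.\<close>

lemma regularized_identity:
  assumes eps: "0 < \<epsilon>" "\<epsilon> \<le> 1"
  shows "(LINT x|lborel. (cmod (f x))\<^sup>2 * (real CARD('n) / (x \<bullet> x + \<epsilon>) - 2 * (x \<bullet> x) / (x \<bullet> x + \<epsilon>)\<^sup>2)) =
      - 2 * Re (LINT x|lborel. of_real (norm x / (x \<bullet> x + \<epsilon>)) * (cnj (f x) * radial x))"
    and "integrable lborel (\<lambda>x. of_real (norm x / (x \<bullet> x + \<epsilon>)) * (cnj (f x) * radial x))"
proof -
  interpret P: weak_product f "D j" j "hardy_field \<epsilon> j" "hardy_field_deriv \<epsilon> j" "1 / \<epsilon>" "3 / \<epsilon>" for j
    by (rule weak_product_hardy_field[OF weak_partial eps])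
  have i1: "integrable lborel (\<lambda>x. (cmod (f x))\<^sup>2 * hardy_field_deriv \<epsilon> j x)" for j
  proof (rule Bochner_Integration.integrable_bound)
    show "integrable lborel (\<lambda>x. (cmod (f x))\<^sup>2 * (3 / \<epsilon>))" using f_int by simp
    show "AE x in lborel. norm ((cmod (f x))\<^sup>2 * hardy_field_deriv \<epsilon> j x) \<le> norm ((cmod (f x))\<^sup>2 * (3 / \<epsilon>))"
      unfolding norm_mult using P.W_bound[of j] eps
      by (intro AE_I2 mult_left_mono) auto
  qed measurable
  have i2: "integrable lborel (\<lambda>x. of_real (hardy_field \<epsilon> j x) * cnj (f x) * D j x)" for j
    using square_integrable_mult[OF P.vf_meas P.D_meas P.vf_int P.D_int] by (simp add: P.vf_def)
  have sum: "(\<Sum>j\<in>UNIV. of_real (hardy_field \<epsilon> j x) * cnj (f x) * D j x) =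
      of_real (norm x / (x \<bullet> x + \<epsilon>)) * (cnj (f x) * radial x)" for x
  proof (cases "x = 0")
    case False
    have "of_real (hardy_field \<epsilon> j x) = of_real (norm x / (x \<bullet> x + \<epsilon>)) * unit_radial j x" for j
      using False by (simp add: hardy_field_def unit_radial_def)
    then show ?thesis by (simp add: radial_def sum_distrib_left mult_ac)
  qed (simp add: hardy_field_def)
  show "integrable lborel (\<lambda>x. of_real (norm x / (x \<bullet> x + \<epsilon>)) * (cnj (f x) * radial x))"
    unfolding sum[symmetric] by (intro Bochner_Integration.integrable_sum i2)
  have "(LINT x|lborel. (cmod (f x))\<^sup>2 * (real CARD('n) / (x \<bullet> x + \<epsilon>) - 2 * (x \<bullet> x) / (x \<bullet> x + \<epsilon>)\<^sup>2)) =
      (\<Sum>j\<in>UNIV. LINT x|lborel. (cmod (f x))\<^sup>2 * hardy_field_deriv \<epsilon> j x)"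
    unfolding hardy_field_deriv_sum[symmetric] sum_distrib_left
    by (rule Bochner_Integration.integral_sum[OF i1])
  also have "\<dots> = (\<Sum>j\<in>UNIV. - 2 * Re (LINT x|lborel. of_real (hardy_field \<epsilon> j x) * cnj (f x) * D j x))"
    using P.product_rule by (simp add: P.vf_def)
  also have "\<dots> = - 2 * Re (\<Sum>j\<in>UNIV. LINT x|lborel. of_real (hardy_field \<epsilon> j x) * cnj (f x) * D j x)"
    by (simp add: sum_distrib_left sum_negf)
  also have "(\<Sum>j\<in>UNIV. LINT x|lborel. of_real (hardy_field \<epsilon> j x) * cnj (f x) * D j x) =
      (LINT x|lborel. of_real (norm x / (x \<bullet> x + \<epsilon>)) * (cnj (f x) * radial x))"
    unfolding sum[symmetric] by (rule Bochner_Integration.integral_sum[OF i2, symmetric])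
  finally show "(LINT x|lborel. (cmod (f x))\<^sup>2 * (real CARD('n) / (x \<bullet> x + \<epsilon>) - 2 * (x \<bullet> x) / (x \<bullet> x + \<epsilon>)\<^sup>2)) =
      - 2 * Re (LINT x|lborel. of_real (norm x / (x \<bullet> x + \<epsilon>)) * (cnj (f x) * radial x))" .
qed

text \<open>Write g for the left integral and N for the squared norm of \<open>radial\<close>. The
  divergence bound and Young's inequality give g \<le> g/2 + 2 N, and absorbing g/2 yields the
  factor 4, independent of \<epsilon>.\<close>

lemma regularized_hardy:
  assumes eps: "0 < \<epsilon>" "\<epsilon> \<le> 1" and dim: "3 \<le> CARD('n)"
  shows "(LINT x|lborel. (cmod (f x))\<^sup>2 / (x \<bullet> x + \<epsilon>)) \<le> 4 * (LINT x|lborel. (cmod (radial x))\<^sup>2)"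
proof -
  let ?s = "\<lambda>x::real^'n. x \<bullet> x + \<epsilon>"
  let ?g = "LINT x|lborel. (cmod (f x))\<^sup>2 / ?s x"
  let ?N = "LINT x|lborel. (cmod (radial x))\<^sup>2"
  let ?c = "\<lambda>x. of_real (norm x / ?s x) * (cnj (f x) * radial x)"
  have pos: "0 < ?s x" for x using eps by (simp add: inner_self_plus_pos)
  \<comment> \<open>The subtracted term is at most 2/s, and n - 1 \<ge> 2 leaves at least
    1/s.\<close>
  have div: "1 / ?s x \<le> real CARD('n) / ?s x - 2 * (x \<bullet> x) / (?s x)\<^sup>2" for x
  proof -
    have "2 * (x \<bullet> x) / (?s x)\<^sup>2 \<le> 2 * ?s x / (?s x)\<^sup>2" using eps by (intro divide_right_mono) auto
    also have "\<dots> = 2 / ?s x" by (rule double_div_square[OF pos[of x]])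
    also have "\<dots> \<le> (real CARD('n) - 1) / ?s x" using dim pos[of x] by (intro divide_right_mono) auto
    finally show ?thesis by (simp add: diff_divide_distrib)
  qed
  have upper: "real CARD('n) / ?s x - 2 * (x \<bullet> x) / (?s x)\<^sup>2 \<le> real CARD('n) / ?s x" for x by simp
  have "?g \<le> (LINT x|lborel. (cmod (f x))\<^sup>2 * (real CARD('n) / ?s x - 2 * (x \<bullet> x) / (?s x)\<^sup>2))"
  proof (rule integral_mono)
    show "integrable lborel (\<lambda>x. (cmod (f x))\<^sup>2 * (real CARD('n) / ?s x - 2 * (x \<bullet> x) / (?s x)\<^sup>2))"
    proof (rule Bochner_Integration.integrable_bound)
      show "integrable lborel (\<lambda>x. real CARD('n) * ((cmod (f x))\<^sup>2 / ?s x))"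
        by (intro integrable_mult_right quotient_int eps(1))
      have "norm ((cmod (f x))\<^sup>2 * (real CARD('n) / ?s x - 2 * (x \<bullet> x) / (?s x)\<^sup>2)) \<le> norm (real CARD('n) * ((cmod (f x))\<^sup>2 / ?s x))" for x
      proof -
        have "0 \<le> real CARD('n) / ?s x - 2 * (x \<bullet> x) / (?s x)\<^sup>2"
          using div[of x] pos[of x] by (meson divide_nonneg_pos order_trans zero_le_one)
        then show ?thesis
          using mult_left_mono[OF upper[of x], of "(cmod (f x))\<^sup>2"] pos[of x]
          by (simp add: mult.commute)
      qed
      then show "AE x in lborel. norm ((cmod (f x))\<^sup>2 * (real CARD('n) / ?s x - 2 * (x \<bullet> x) / (?s x)\<^sup>2)) \<le> norm (real CARD('n) * ((cmod (f x))\<^sup>2 / ?s x))" by simp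
    qed measurable
    show "(cmod (f x))\<^sup>2 / ?s x \<le> (cmod (f x))\<^sup>2 * (real CARD('n) / ?s x - 2 * (x \<bullet> x) / (?s x)\<^sup>2)" for x
      using mult_left_mono[OF div[of x], of "(cmod (f x))\<^sup>2"] by simp
  qed (rule quotient_int[OF eps(1)])
  also have "\<dots> = - 2 * Re (LINT x|lborel. ?c x)" by (rule regularized_identity(1)[OF eps])
  also have "\<dots> \<le> 2 * cmod (LINT x|lborel. ?c x)" using abs_Re_le_cmod[of "LINT x|lborel. ?c x"] by linarith
  also have "\<dots> \<le> 2 * (LINT x|lborel. (cmod (f x))\<^sup>2 / ?s x / 4 + (cmod (radial x))\<^sup>2)"
  proof (intro mult_left_mono Bochner_Integration.integral_norm_bound_integral regularized_identity(2)[OF eps])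
    show "integrable lborel (\<lambda>x. (cmod (f x))\<^sup>2 / ?s x / 4 + (cmod (radial x))\<^sup>2)"
      by (intro Bochner_Integration.integrable_add integrable_divide_zero radial_int quotient_int eps(1))
    fix x
    define a where "a = norm x / ?s x * cmod (f x)"
    have "a\<^sup>2 = (x \<bullet> x) / (?s x)\<^sup>2 * (cmod (f x))\<^sup>2"
      by (simp add: a_def power_mult_distrib power_divide power2_norm_eq_inner)
    also have "\<dots> \<le> ?s x / (?s x)\<^sup>2 * (cmod (f x))\<^sup>2"
      using eps by (intro mult_right_mono divide_right_mono) auto
    also have "\<dots> = (cmod (f x))\<^sup>2 / ?s x" using pos[of x] by (simp add: power2_eq_square)
    finally have a2: "a\<^sup>2 \<le> (cmod (f x))\<^sup>2 / ?s x" .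
    have "cmod (?c x) = \<bar>norm x / ?s x\<bar> * (cmod (cnj (f x)) * cmod (radial x))"
      by (simp only: norm_mult norm_of_real)
    also have "\<dots> = a * cmod (radial x)" using pos[of x] by (simp add: a_def)
    \<comment> \<open>Weight 2 in Young's inequality: after the outer factor 2, the first term
      becomes exactly half of the quantity to be bounded.\<close>
    also have "\<dots> \<le> a\<^sup>2 / 4 + (cmod (radial x))\<^sup>2"
      using weighted_young[of 2 a "cmod (radial x)"] by simp
    also have "\<dots> \<le> (cmod (f x))\<^sup>2 / ?s x / 4 + (cmod (radial x))\<^sup>2"
      by (intro add_right_mono divide_right_mono a2) simp
    finally show "cmod (?c x) \<le> (cmod (f x))\<^sup>2 / ?s x / 4 + (cmod (radial x))\<^sup>2" .
  qed auto
  also have "\<dots> = ?g / 2 + 2 * ?N"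
  proof -
    have "(LINT x|lborel. u x / 4 + v x) = (LINT x|lborel. u x) / 4 + (LINT x|lborel. v x)"
      if "integrable lborel u" "integrable lborel v" for u v :: "real^'n \<Rightarrow> real"
      using that by simp
    from this[OF quotient_int[OF eps(1)] radial_int] show ?thesis by simp
  qed
  finally show ?thesis by simp
qed

lemma AE_nonzero: "AE x::real^'n in lborel. x \<noteq> 0"
  by (rule AE_lborel_singleton)

text \<open>Monotone convergence: the regularized quotients increase as \<epsilon> = 1/(k + 1)
  decreases, and \<open>regularized_hardy\<close> bounds their integrals uniformly.\<close>

lemma hardy_integrable:
  assumes dim: "3 \<le> CARD('n)"
  shows "integrable lborel (\<lambda>x. (cmod (f x))\<^sup>2 / (x \<bullet> x))"
proof -
  define \<epsilon> where "\<epsilon> k = inverse (real (Suc k))" for k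
  have eps: "0 < \<epsilon> k" "\<epsilon> k \<le> 1" for k by (auto simp: \<epsilon>_def inverse_le_1_iff)
  have eps0: "\<epsilon> \<longlonglongrightarrow> 0" unfolding \<epsilon>_def by (rule LIMSEQ_inverse_real_of_nat)
  let ?q = "\<lambda>k x. (cmod (f x))\<^sup>2 / (x \<bullet> x + \<epsilon> k)"
  have mono: "mono (\<lambda>k. ?q k x)" for x
  proof (rule monoI)
    fix k l :: nat assume "k \<le> l"
    then have "\<epsilon> l \<le> \<epsilon> k" by (simp add: \<epsilon>_def field_simps)
    then show "?q k x \<le> ?q l x" using eps
      by (intro divide_left_mono) (auto intro!: mult_pos_pos inner_self_plus_pos)
  qed
  have inc: "incseq (\<lambda>k. LINT x|lborel. ?q k x)"
    using mono by (intro incseq_SucI integral_mono quotient_int eps) (auto simp: incseq_Suc_iff)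
  have bound: "\<forall>k. (LINT x|lborel. ?q k x) \<le> 4 * (LINT x|lborel. (cmod (radial x))\<^sup>2)"
    by (intro allI regularized_hardy[OF eps dim])
  obtain L where L: "(\<lambda>k. LINT x|lborel. ?q k x) \<longlonglongrightarrow> L"
    by (rule incseq_convergent[OF inc bound])
  show ?thesis
  proof (rule integrable_monotone_convergence[OF quotient_int[OF eps(1)] _ _ L])
    show "AE x in lborel. mono (\<lambda>k. ?q k x)" using mono by simp
    show "AE x in lborel. (\<lambda>k. ?q k x) \<longlonglongrightarrow> (cmod (f x))\<^sup>2 / (x \<bullet> x)"
      using AE_nonzero
    proof eventually_elim
      case (elim x)
      have "(\<lambda>k. x \<bullet> x + \<epsilon> k) \<longlonglongrightarrow> x \<bullet> x + 0" by (intro tendsto_intros eps0)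
      then show ?case using elim by (intro tendsto_divide tendsto_const) auto
    qed
  qed measurable
qed

text \<open>The limit \<epsilon> \<rightarrow> 0 of \<open>regularized_identity\<close>. Dominated
  convergence applies on both sides only because |f|^2/|x|^2 is already known to be integrable;
  pointwise n/|x|^2 - 2 |x|^2/|x|^4 becomes (n - 2)/|x|^2.\<close>

lemma hardy_identity:
  assumes dim: "3 \<le> CARD('n)"
  shows "(real CARD('n) - 2) * (LINT x|lborel. (cmod (f x))\<^sup>2 / (x \<bullet> x)) =
    - 2 * Re (LINT x|lborel. of_real (1 / norm x) * (cnj (f x) * radial x))"
proof -
  define \<epsilon> where "\<epsilon> k = inverse (real (Suc k))" for k
  have eps: "0 < \<epsilon> k" "\<epsilon> k \<le> 1" for k by (auto simp: \<epsilon>_def inverse_le_1_iff)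
  have eps0: "\<epsilon> \<longlonglongrightarrow> 0" unfolding \<epsilon>_def by (rule LIMSEQ_inverse_real_of_nat)
  let ?s = "\<lambda>k x::real^'n. x \<bullet> x + \<epsilon> k"
  have pos: "0 < ?s k x" for k x using eps by (simp add: inner_self_plus_pos)
  have slim: "(\<lambda>k. ?s k x) \<longlonglongrightarrow> x \<bullet> x" for x
    using tendsto_add[OF tendsto_const[of "x \<bullet> x"] eps0] by simp
  let ?l = "\<lambda>k x. (cmod (f x))\<^sup>2 * (real CARD('n) / ?s k x - 2 * (x \<bullet> x) / (?s k x)\<^sup>2)"
  have "(\<lambda>k. LINT x|lborel. ?l k x) \<longlonglongrightarrow> (LINT x|lborel. (real CARD('n) - 2) * ((cmod (f x))\<^sup>2 / (x \<bullet> x)))"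
  proof (rule integral_dominated_convergence)
    \<comment> \<open>The majorant has n + 2 in place of n - 2 because the two terms are estimated
      separately.\<close>
    show "integrable lborel (\<lambda>x. (real CARD('n) + 2) * ((cmod (f x))\<^sup>2 / (x \<bullet> x)))"
      by (intro integrable_mult_right hardy_integrable[OF dim])
    show "AE x in lborel. (\<lambda>k. ?l k x) \<longlonglongrightarrow> (real CARD('n) - 2) * ((cmod (f x))\<^sup>2 / (x \<bullet> x))"
      using AE_nonzero
    proof eventually_elim
      case (elim x)
      have "(\<lambda>k. ?l k x) \<longlonglongrightarrow> (cmod (f x))\<^sup>2 * (real CARD('n) / (x \<bullet> x) - 2 * (x \<bullet> x) / (x \<bullet> x)\<^sup>2)"
        using elim by (intro tendsto_intros slim) auto
      also have "(cmod (f x))\<^sup>2 * (real CARD('n) / (x \<bullet> x) - 2 * (x \<bullet> x) / (x \<bullet> x)\<^sup>2) = (real CARD('n) - 2) * ((cmod (f x))\<^sup>2 / (x \<bullet> x))"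
        using elim by (simp add: power2_eq_square field_simps)
      finally show ?case .
    qed
    show "AE x in lborel. norm (?l k x) \<le> (real CARD('n) + 2) * ((cmod (f x))\<^sup>2 / (x \<bullet> x))" for k
      using AE_nonzero
    proof eventually_elim
      case (elim x)
      then have x: "0 < x \<bullet> x" by simp
      have "1 / ?s k x \<le> 1 / (x \<bullet> x)" using x eps(1)[of k] by (intro divide_left_mono mult_pos_pos add_pos_pos) auto
      then have 1: "real CARD('n) / ?s k x \<le> real CARD('n) / (x \<bullet> x)"
        using mult_left_mono[of "1 / ?s k x" "1 / (x \<bullet> x)" "real CARD('n)"] by simp
      have "2 * (x \<bullet> x) / (?s k x)\<^sup>2 \<le> 2 * (x \<bullet> x) / (x \<bullet> x)\<^sup>2"
        using x eps(1)[of k] by (intro divide_left_mono power_mono mult_pos_pos zero_less_power add_pos_pos) auto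
      also have "\<dots> = 2 / (x \<bullet> x)" using x by (simp add: power2_eq_square)
      finally have 2: "2 * (x \<bullet> x) / (?s k x)\<^sup>2 \<le> 2 / (x \<bullet> x)" .
      have 3: "0 \<le> real CARD('n) / ?s k x" "0 \<le> 2 * (x \<bullet> x) / (?s k x)\<^sup>2" using pos[of x k] x by auto
      have "\<bar>real CARD('n) / ?s k x - 2 * (x \<bullet> x) / (?s k x)\<^sup>2\<bar> \<le> real CARD('n) / (x \<bullet> x) + 2 / (x \<bullet> x)"
        using 1 2 3 by linarith
      from mult_left_mono[OF this, of "(cmod (f x))\<^sup>2"]
      have "norm (?l k x) \<le> (cmod (f x))\<^sup>2 * (real CARD('n) / (x \<bullet> x) + 2 / (x \<bullet> x))"
        by (simp only: real_norm_def abs_mult abs_power2 zero_le_power2)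
      also have "\<dots> = (real CARD('n) + 2) * ((cmod (f x))\<^sup>2 / (x \<bullet> x))"
        by (simp add: add_divide_distrib algebra_simps)
      finally show ?case .
    qed
  qed measurable
  moreover have "(\<lambda>k. - 2 * Re (LINT x|lborel. of_real (norm x / ?s k x) * (cnj (f x) * radial x)))
      \<longlonglongrightarrow> - 2 * Re (LINT x|lborel. of_real (1 / norm x) * (cnj (f x) * radial x))"
  proof (intro tendsto_mult tendsto_const tendsto_Re, rule integral_dominated_convergence)
    show "integrable lborel (\<lambda>x. (cmod (f x))\<^sup>2 / (x \<bullet> x) + (cmod (radial x))\<^sup>2)"
      using hardy_integrable[OF dim] radial_int by simp
    show "AE x in lborel. (\<lambda>k. of_real (norm x / ?s k x) * (cnj (f x) * radial x))
        \<longlonglongrightarrow> of_real (1 / norm x) * (cnj (f x) * radial x)"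
      using AE_nonzero
    proof eventually_elim
      case (elim x)
      then have "(\<lambda>k. norm x / ?s k x) \<longlonglongrightarrow> norm x / (x \<bullet> x)" by (intro tendsto_intros slim) auto
      also have "norm x / (x \<bullet> x) = 1 / norm x"
        using elim by (simp add: power2_norm_eq_inner[symmetric] power2_eq_square)
      finally show ?case by (intro tendsto_mult tendsto_of_real tendsto_const)
    qed
    show "AE x in lborel. norm (of_real (norm x / ?s k x) * (cnj (f x) * radial x)) \<le>
        (cmod (f x))\<^sup>2 / (x \<bullet> x) + (cmod (radial x))\<^sup>2" for k
      using AE_nonzero
    proof eventually_elim
      case (elim x)
      then have x: "0 < x \<bullet> x" by simp
      have "norm x / ?s k x \<le> norm x / (x \<bullet> x)" using x eps(1)[of k] by (intro divide_left_mono mult_pos_pos add_pos_pos) auto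
      also have "norm x / (x \<bullet> x) = 1 / norm x"
        using elim by (simp add: power2_norm_eq_inner[symmetric] power2_eq_square)
      finally have "cmod (of_real (norm x / ?s k x)) \<le> 1 / norm x"
        using pos[of x k] by (simp add: norm_of_real del: of_real_divide of_real_add)
      then have "cmod (of_real (norm x / ?s k x) * (cnj (f x) * radial x)) \<le> 1 / norm x * cmod (cnj (f x) * radial x)"
        unfolding norm_mult[of "of_real (norm x / ?s k x)"] by (intro mult_right_mono) auto
      also have "\<dots> = cmod (of_real (1 / norm x) * cnj (f x) * radial x)"
        by (simp add: norm_mult norm_divide)
      also have "\<dots> \<le> (cmod (of_real (1 / norm x) * cnj (f x)))\<^sup>2 + (cmod (radial x))\<^sup>2"
        by (rule norm_mult_le_squares)
      also have "\<dots> = (cmod (f x))\<^sup>2 / (x \<bullet> x) + (cmod (radial x))\<^sup>2"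
        by (simp add: norm_mult norm_divide power_divide power2_norm_eq_inner)
      finally show ?case .
    qed
  qed measurable
  ultimately have "(LINT x|lborel. (real CARD('n) - 2) * ((cmod (f x))\<^sup>2 / (x \<bullet> x))) =
      - 2 * Re (LINT x|lborel. of_real (1 / norm x) * (cnj (f x) * radial x))"
    unfolding regularized_identity(1)[OF eps] by (rule LIMSEQ_unique)
  then show ?thesis by (simp only: integral_mult_right_zero)
qed

end

subsection \<open>The operators\<close>

lemma L2_nrm_square: "(L2_nrm f)\<^sup>2 = (LINT x|lebesgue. (cmod (f x))\<^sup>2)"
  by (simp add: L2_nrm_def)

lemma L2_nrm_cong_AE:
  assumes "f \<in> L2" "g \<in> L2" "AE x in lebesgue. f x = g x"
  shows "L2_nrm f = L2_nrm g"
proof -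
  have "(LINT x|lebesgue. (cmod (f x))\<^sup>2) = (LINT x|lebesgue. (cmod (g x))\<^sup>2)"
    using assms(3) L2_D(2)[OF assms(1)] L2_D(2)[OF assms(2)]
    by (intro integral_cong_AE borel_measurable_integrable) (auto elim: eventually_mono)
  then show ?thesis by (simp add: L2_nrm_def)
qed

lemma L2_nrm_pos:
  assumes "f \<in> L2" "\<not> (AE x in lebesgue. f x = 0)"
  shows "0 < L2_nrm f"
proof -
  have "(LINT x|lebesgue. (cmod (f x))\<^sup>2) \<noteq> 0"
    using assms integral_nonneg_eq_0_iff_AE[OF L2_D(2)[OF assms(1)]] by simp
  moreover have "0 \<le> (LINT x|lebesgue. (cmod (f x))\<^sup>2)" by simp
  ultimately have "0 < (LINT x|lebesgue. (cmod (f x))\<^sup>2)" by linarith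
  then show ?thesis by (simp add: L2_nrm_def)
qed

lemma ip_integrable: "f \<in> L2 \<Longrightarrow> g \<in> L2 \<Longrightarrow> integrable lebesgue (\<lambda>x. f x * cnj (g x))"
  by (intro L2_mult_integrable L2_cnj)

lemma ip_commute: "ip g f = cnj (ip f g)"
  unfolding ip_def by (subst Bochner_Integration.integral_cnj[symmetric]) (simp add: mult.commute)

lemma ip_self: "ip f f = of_real ((L2_nrm f)\<^sup>2)"
  unfolding ip_def L2_nrm_square complex_norm_square[symmetric]
  by (simp flip: integral_of_real of_real_power)

lemma ip_cong_AE:
  assumes "f \<in> L2" "f' \<in> L2" "g \<in> L2" "AE x in lebesgue. f x = f' x"
  shows "ip f g = ip f' g"
  unfolding ip_def using assms
  by (intro integral_cong_AE borel_measurable_integrable ip_integrable) (auto elim: eventually_mono)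

lemma ip_linear_left:
  assumes "f \<in> L2" "g \<in> L2" "h \<in> L2"
  shows "ip (\<lambda>x. a * f x + b * g x) h = a * ip f h + b * ip g h"
  using ip_integrable[OF assms(1,3)] ip_integrable[OF assms(2,3)]
  by (simp add: ip_def distrib_right mult.assoc)

text \<open>Serves two purposes: the norm of \<open>A\<close> as a combination of the radial
  derivative and \<open>B\<close>, and the norm of the sum of the normalized vectors.\<close>

lemma L2_nrm_combination:
  assumes "f \<in> L2" "g \<in> L2"
  shows "(L2_nrm (\<lambda>x. a * f x + b * g x))\<^sup>2 =
    (cmod a)\<^sup>2 * (L2_nrm f)\<^sup>2 + (cmod b)\<^sup>2 * (L2_nrm g)\<^sup>2 + 2 * Re (a * cnj b * ip f g)"
proof -
  have "(cmod (a * f x + b * g x))\<^sup>2 = (cmod a)\<^sup>2 * (cmod (f x))\<^sup>2 + (cmod b)\<^sup>2 * (cmod (g x))\<^sup>2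
      + 2 * Re (a * cnj b * (f x * cnj (g x)))" for x
    unfolding cmod_power2 by (simp add: power2_eq_square algebra_simps)
  then have "(L2_nrm (\<lambda>x. a * f x + b * g x))\<^sup>2 =
      (LINT x|lebesgue. (cmod a)\<^sup>2 * (cmod (f x))\<^sup>2 + (cmod b)\<^sup>2 * (cmod (g x))\<^sup>2
      + 2 * Re (a * cnj b * (f x * cnj (g x))))"
    by (simp only: L2_nrm_square)
  also have "\<dots> = (cmod a)\<^sup>2 * (L2_nrm f)\<^sup>2 + (cmod b)\<^sup>2 * (L2_nrm g)\<^sup>2 + 2 * Re (a * cnj b * ip f g)"
    using L2_D(2)[OF assms(1)] L2_D(2)[OF assms(2)] ip_integrable[OF assms]
    by (simp add: L2_nrm_square ip_def del: times_complex.sel)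
  finally show ?thesis .
qed

section \<open>The distributional radial derivative and \<open>A\<close>\<close>

lemma unit_radial_bound: "cmod (unit_radial j x) \<le> 1"
  using component_le_norm_cart[of x j] by (auto simp: unit_radial_def divide_le_eq_1 norm_divide)

lemma unit_radial_L2:
  assumes "f \<in> L2"
  shows "(\<lambda>x. unit_radial j x * f x) \<in> L2"
  using unit_radial_meas[of j] unit_radial_bound
  by (intro L2_mult_bounded[OF assms, of _ 1]) (simp_all add: measurable_completion)

text \<open>In \<open>radial_grad\<close> the factor x_j/|x| is differentiated together with \<psi>,
  in \<open>radial_div\<close> it stays outside the derivative. The difference of the two is the
  divergence of x/|x| paired with u \<psi>, and it is integrable because u/|x| is in
  \<open>L2\<close>.\<close>

lemma radial_div_eq:
  fixes u :: "real^'n \<Rightarrow> complex"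
  assumes u: "u \<in> L2" "(\<lambda>x. inv_norm x * u x) \<in> L2" and t: "\<psi> \<in> test_functions punctured"
  shows "radial_div u \<psi> = radial_grad u \<psi> + (of_nat CARD('n) - 1) * (LINT x|lebesgue. (inv_norm x * u x) * \<psi> x)"
proof -
  let ?p = "\<lambda>j. partial j (\<lambda>x. unit_radial j x * \<psi> x)"
  have i1: "integrable lebesgue (\<lambda>x. u x * ?p j x)" for j
    by (intro L2_mult_integrable u(1)
        test_functions_L2[OF test_functions_partial[OF test_functions_punctured_mult_unit_radial[OF t]]])
  have i2: "integrable lebesgue (\<lambda>x. unit_radial j x * u x * partial j \<psi> x)" for j
    by (intro L2_mult_integrable unit_radial_L2 u(1) test_functions_L2[OF test_functions_partial[OF t]])
  have i3: "integrable lebesgue (\<lambda>x. (inv_norm x * u x) * \<psi> x)"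
    by (intro L2_mult_integrable u(2) test_functions_L2[OF t])
  have ae: "AE x::real^'n in lebesgue. (\<Sum>j\<in>UNIV. u x * ?p j x - unit_radial j x * u x * partial j \<psi> x)
      = (of_nat CARD('n) - 1) * ((inv_norm x * u x) * \<psi> x)"
    unfolding AE_lebesgue_iff using AE_lborel_singleton[of 0]
  proof eventually_elim
    case (elim x)
    have "(\<Sum>j\<in>UNIV. u x * ?p j x - unit_radial j x * u x * partial j \<psi> x) =
        (\<Sum>j\<in>UNIV. (inv_norm x - of_real ((x $ j)\<^sup>2) * inv_norm x ^ 3)) * (u x * \<psi> x)"
      unfolding unit_radial_partial_mult[OF t elim] sum_distrib_right
      by (intro sum.cong) (auto simp: algebra_simps)
    then show ?case unfolding unit_radial_div[OF elim] by (simp add: mult_ac)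
  qed
  have "radial_div u \<psi> - radial_grad u \<psi> =
      (\<Sum>j\<in>UNIV. (LINT x|lebesgue. u x * ?p j x) - (LINT x|lebesgue. unit_radial j x * u x * partial j \<psi> x))"
    by (simp add: radial_div_def radial_grad_def dist_mult_def dist_deriv_def dist_of_def sum_subtractf sum_negf)
  also have "\<dots> = (LINT x|lebesgue. (\<Sum>j\<in>UNIV. u x * ?p j x - unit_radial j x * u x * partial j \<psi> x))"
    using i1 i2 by simp
  also have "\<dots> = (LINT x|lebesgue. (of_nat CARD('n) - 1) * ((inv_norm x * u x) * \<psi> x))"
    using i1 i2 i3 by (intro integral_cong_AE ae borel_measurable_integrable) auto
  also have "\<dots> = (of_nat CARD('n) - 1) * (LINT x|lebesgue. (inv_norm x * u x) * \<psi> x)"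
    by (rule integral_mult_right_zero)
  finally show ?thesis by (simp add: algebra_simps)
qed

text \<open>\<open>op_A\<close> is known only through a choice, so a representative is exhibited and
  uniqueness up to null sets is invoked. By \<open>radial_div_eq\<close> the two distributions add
  up to 2 g + (n - 1) u/|x|, and 1/(2 \<i>) = - \<i>/2.\<close>

lemma op_A_represented:
  fixes u :: "real^'n \<Rightarrow> complex"
  assumes u: "u \<in> L2" "(\<lambda>x. inv_norm x * u x) \<in> L2" and g: "L2_represents punctured (radial_grad u) g"
  shows "op_A u \<in> L2"
    and "AE x in lebesgue. op_A u x = - \<i> * g x + - \<i> * ((of_nat CARD('n) - 1) / 2) * (inv_norm x * u x)"
proof -
  let ?c = "(of_nat CARD('n) - 1) / 2 :: complex"
  let ?T = "\<lambda>\<psi>. 1 / (2 * \<i>) * (radial_grad u \<psi> + radial_div u \<psi>)"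
  have gL2: "g \<in> L2" using g by (simp add: L2_represents_def)
  have rep: "L2_represents punctured ?T (\<lambda>x. - \<i> * g x + - \<i> * ?c * (inv_norm x * u x))"
    unfolding L2_represents_def
  proof (intro conjI ballI)
    show "(\<lambda>x. - \<i> * g x + - \<i> * ?c * (inv_norm x * u x)) \<in> L2"
      by (intro L2_add L2_scale gL2 u(2))
    fix \<psi> :: "real^'n \<Rightarrow> complex" assume t: "\<psi> \<in> test_functions punctured"
    have i: "integrable lebesgue (\<lambda>x. g x * \<psi> x)" "integrable lebesgue (\<lambda>x. (inv_norm x * u x) * \<psi> x)"
      by (intro L2_mult_integrable gL2 u(2) test_functions_L2[OF t])+
    let ?I = "LINT x|lebesgue. (inv_norm x * u x) * \<psi> x"
    have grad: "radial_grad u \<psi> = (LINT x|lebesgue. g x * \<psi> x)"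
      using g t by (simp add: L2_represents_def dist_of_def)
    have "dist_of (\<lambda>x. - \<i> * g x + - \<i> * ?c * (inv_norm x * u x)) \<psi> =
        (LINT x|lebesgue. - \<i> * (g x * \<psi> x) + - \<i> * ?c * ((inv_norm x * u x) * \<psi> x))"
      by (simp only: dist_of_def distrib_right mult.assoc)
    also have "\<dots> = - \<i> * (LINT x|lebesgue. g x * \<psi> x) + - \<i> * ?c * ?I"
      by (subst Bochner_Integration.integral_add) (intro integrable_mult_right i, intro integrable_mult_right i, simp only: integral_mult_right_zero)
    also have "\<dots> = ?T \<psi>"
      unfolding radial_div_eq[OF u t] grad by (simp add: field_simps)
    finally show "?T \<psi> = dist_of (\<lambda>x. - \<i> * g x + - \<i> * ?c * (inv_norm x * u x)) \<psi>" by simp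
  qed
  show "op_A u \<in> L2"
    using L2_represents_L2_rep[OF rep] by (simp add: op_A_def L2_represents_def)
  show "AE x in lebesgue. op_A u x = - \<i> * g x + - \<i> * ?c * (inv_norm x * u x)"
    using L2_rep_AE_eq[OF rep punctured_open] by (simp add: op_A_def)
qed

lemma weak_deriv_represents:
  "f \<in> H1 \<Longrightarrow> L2_represents UNIV (dist_deriv j (dist_of f)) (weak_deriv j f)"
  unfolding H1_def weak_deriv_def by (auto intro: L2_represents_L2_rep)

lemma radial_deriv_H1_L2:
  assumes "f \<in> H1"
  shows "radial_deriv_H1 f \<in> L2"
  unfolding radial_deriv_H1_def[abs_def]
  using weak_deriv_represents[OF assms] by (intro L2_sum unit_radial_L2) (auto simp: L2_represents_def)

text \<open>Links the two radial derivatives. A test function of the punctured space times x_j/|x|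
  is also a test function on the whole space, where the weak derivatives of \<open>f\<close> are
  defined.\<close>

lemma radial_grad_represented:
  assumes f: "f \<in> H1"
  shows "L2_represents punctured (radial_grad f) (radial_deriv_H1 f)"
  unfolding L2_represents_def
proof (intro conjI ballI radial_deriv_H1_L2 f)
  fix \<psi> :: "real^'a \<Rightarrow> complex" assume t: "\<psi> \<in> test_functions punctured"
  have w: "weak_deriv j f \<in> L2" for j
    using weak_deriv_represents[OF f, of j] by (simp add: L2_represents_def)
  have "dist_mult (unit_radial j) (dist_deriv j (dist_of f)) \<psi> =
      (LINT x|lebesgue. unit_radial j x * weak_deriv j f x * \<psi> x)" for j
  proof -
    have "(\<lambda>x. unit_radial j x * \<psi> x) \<in> test_functions UNIV"
      using test_functions_punctured_mult_unit_radial[OF t] test_functions_mono[OF subset_UNIV] by blast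
    then show ?thesis
      using weak_deriv_represents[OF f, of j]
      by (simp add: L2_represents_def dist_mult_def dist_of_def mult_ac)
  qed
  then show "radial_grad f \<psi> = dist_of (radial_deriv_H1 f) \<psi>"
    unfolding radial_grad_def dist_of_def radial_deriv_H1_def sum_distrib_right
    by (subst Bochner_Integration.integral_sum)
      (auto intro!: L2_mult_integrable unit_radial_L2 w test_functions_L2[OF t])
qed

text \<open>Transfers the results of \<open>weak_gradient\<close> from Borel representatives and
  \<open>lborel\<close> to the given function, its chosen weak derivatives and the completed
  measure.\<close>

lemma H1_hardy:
  fixes \<phi> :: "real^'n \<Rightarrow> complex"
  assumes \<phi>: "\<phi> \<in> H1" and dim: "3 \<le> CARD('n)"
  shows "op_B \<phi> \<in> L2"
    and "2 * Re (ip (radial_deriv_H1 \<phi>) (op_B \<phi>)) = - (real CARD('n) - 2) * (L2_nrm (op_B \<phi>))\<^sup>2"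
proof -
  have \<phi>L2: "\<phi> \<in> L2" using \<phi> by (simp add: H1_def)
  obtain f where f: "f \<in> borel_measurable borel" "f \<in> L2" "AE x in lebesgue. \<phi> x = f x"
    using L2_borel_representative[OF \<phi>L2] .
  have wL2: "weak_deriv j \<phi> \<in> L2" for j
    using weak_deriv_represents[OF \<phi>, of j] by (simp add: L2_represents_def)
  have "\<exists>g. g \<in> borel_measurable borel \<and> g \<in> L2 \<and> (AE x in lebesgue. weak_deriv j \<phi> x = g x)" for j
    using L2_borel_representative[OF wL2[of j]] by metis
  then obtain D where D: "\<And>j. D j \<in> borel_measurable borel" "\<And>j. D j \<in> L2"
    "\<And>j. AE x in lebesgue. weak_deriv j \<phi> x = D j x" by metis
  have sq: "integrable lborel (\<lambda>x. (cmod (g x))\<^sup>2)" if "g \<in> borel_measurable borel" "g \<in> L2"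
    for g :: "real^'n \<Rightarrow> complex"
    using L2_D(2)[OF that(2)] that(1) by (simp add: integrable_completion)
  have pairing: "(LINT x|lebesgue. g x * \<psi> x) = (LINT x|lborel. g' x * \<psi> x)"
    if "g \<in> L2" "g' \<in> L2" "g' \<in> borel_measurable borel" "AE x in lebesgue. g x = g' x" "\<psi> \<in> test_functions UNIV"
    for g g' \<psi> :: "real^'n \<Rightarrow> complex"
  proof -
    have "(LINT x|lebesgue. g x * \<psi> x) = (LINT x|lebesgue. g' x * \<psi> x)"
      using that(4) by (intro integral_cong_AE borel_measurable_integrable L2_mult_integrable that(1,2)
          test_functions_L2[OF that(5)]) (auto elim: eventually_mono)
    also have "\<dots> = (LINT x|lborel. g' x * \<psi> x)"
      using that(3) test_functions_measurable[OF that(5)] by (intro integral_completion) simp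
    finally show ?thesis .
  qed
  interpret weak_gradient f D
  proof (intro weak_gradient.intro weak_partial_derivative.intro f(1) D(1) sq f(2) D(2))
    fix j :: 'n and \<psi> :: "real^'n \<Rightarrow> complex" assume t: "\<psi> \<in> test_functions UNIV"
    have "- (LINT x|lebesgue. \<phi> x * partial j \<psi> x) = (LINT x|lebesgue. weak_deriv j \<phi> x * \<psi> x)"
      using weak_deriv_represents[OF \<phi>, of j] t by (simp add: L2_represents_def dist_deriv_def dist_of_def)
    then show "(LINT x|lborel. f x * partial j \<psi> x) = - (LINT x|lborel. D j x * \<psi> x)"
      unfolding pairing[OF \<phi>L2 f(2,1,3) test_functions_partial[OF t]] pairing[OF wL2 D(2,1,3) t]
      by (metis minus_minus)
  qed
  have inv_meas: "inv_norm \<in> borel_measurable (borel :: (real^'n) measure)"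
    unfolding inv_norm_def[abs_def] by measurable
  define G where "G x = inv_norm x * f x" for x
  have G_meas: "G \<in> borel_measurable borel"
    unfolding G_def[abs_def] using inv_meas f(1) by measurable
  have G_sq: "(cmod (G x))\<^sup>2 = (cmod (f x))\<^sup>2 / (x \<bullet> x)" for x
    by (simp add: G_def inv_norm_def norm_mult norm_divide power_divide power2_norm_eq_inner)
  have G_L2: "G \<in> L2"
    using hardy_integrable[OF dim] G_meas
    by (simp add: L2_def measurable_completion integrable_completion G_sq)
  have B_ae: "AE x in lebesgue. G x = op_B \<phi> x"
    using f(3) by eventually_elim (simp add: G_def op_B_def)
  have "op_B \<phi> \<in> borel_measurable lebesgue"
    unfolding op_B_def[abs_def] using inv_meas \<phi>L2
    by (intro borel_measurable_times) (simp_all add: measurable_completion L2_def)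
  then show B_L2: "op_B \<phi> \<in> L2" using L2_cong_AE[OF G_L2 _ B_ae] by simp
  have rad_L2: "radial \<in> L2"
    using radial_int radial_meas by (simp add: L2_def measurable_completion integrable_completion)
  have "AE x in lebesgue. \<forall>j\<in>UNIV. weak_deriv j \<phi> x = D j x"
    using D(3) by (intro AE_finite_allI) auto
  then have R_ae: "AE x in lebesgue. radial_deriv_H1 \<phi> x = radial x"
    by eventually_elim (simp add: radial_deriv_H1_def radial_def)
  have "ip (radial_deriv_H1 \<phi>) (op_B \<phi>) = ip radial (op_B \<phi>)"
    by (rule ip_cong_AE[OF radial_deriv_H1_L2[OF \<phi>] rad_L2 B_L2 R_ae])
  \<comment> \<open>\<open>ip_cong_AE\<close> exchanges the first argument only; conjugate symmetry
    brings the second argument there and back.\<close>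
  also have "\<dots> = cnj (ip (op_B \<phi>) radial)" by (rule ip_commute)
  also have "ip (op_B \<phi>) radial = ip G radial"
    using B_ae by (intro ip_cong_AE B_L2 G_L2 rad_L2) (auto elim: eventually_mono)
  also have "cnj (ip G radial) = ip radial G" by (rule ip_commute[symmetric])
  also have "\<dots> = (LINT x|lebesgue. of_real (1 / norm x) * (cnj (f x) * radial x))"
    unfolding ip_def G_def inv_norm_def by (intro Bochner_Integration.integral_cong) (simp_all add: mult_ac)
  also have "\<dots> = (LINT x|lborel. of_real (1 / norm x) * (cnj (f x) * radial x))"
    by (intro integral_completion) measurable
  finally have ip: "ip (radial_deriv_H1 \<phi>) (op_B \<phi>) = (LINT x|lborel. of_real (1 / norm x) * (cnj (f x) * radial x))" .
  have "(L2_nrm (op_B \<phi>))\<^sup>2 = (L2_nrm G)\<^sup>2"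
    using L2_nrm_cong_AE[OF G_L2 B_L2 B_ae] by simp
  also have "\<dots> = (LINT x|lborel. (cmod (f x))\<^sup>2 / (x \<bullet> x))"
    using G_meas unfolding L2_nrm_square G_sq[symmetric] by (intro integral_completion) measurable
  finally have nrm: "(L2_nrm (op_B \<phi>))\<^sup>2 = (LINT x|lborel. (cmod (f x))\<^sup>2 / (x \<bullet> x))" .
  show "2 * Re (ip (radial_deriv_H1 \<phi>) (op_B \<phi>)) = - (real CARD('n) - 2) * (L2_nrm (op_B \<phi>))\<^sup>2"
    unfolding ip nrm using hardy_identity[OF dim] by linarith
qed

theorem theorem3p5:
  fixes \<phi> :: "real^'n \<Rightarrow> complex"
  assumes dim: "CARD('n) \<ge> 3"
    and H1: "\<phi> \<in> H1"
    and A_nonzero: "\<not> (AE x in lebesgue. op_A \<phi> x = 0)"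
    and B_nonzero: "\<not> (AE x in lebesgue. op_B \<phi> x = 0)"
  shows "(\<forall>u \<in> (dom_A :: (real^'n \<Rightarrow> complex) set). AE x in lebesgue.
            op_A u x = - \<i> * L2_rep punctured (radial_grad u) x
                       - \<i> * ((of_nat CARD('n) - 1) / 2 * inv_norm x) * u x)
    \<and> \<phi> \<in> dom_A \<inter> dom_B
    \<and> complex_of_real ((L2_nrm (op_B \<phi>))\<^sup>2) = - \<i> * commutator_form op_A op_B \<phi> \<phi>
    \<and> - \<i> * commutator_form op_A op_B \<phi> \<phi> = complex_of_real (- 2 * Im (ip (op_A \<phi>) (op_B \<phi>)))
    \<and> - 2 * Im (ip (op_A \<phi>) (op_B \<phi>)) =
        L2_nrm (op_A \<phi>) * L2_nrm (op_B \<phi>) *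
          (2 - (L2_nrm (\<lambda>x. op_A \<phi> x / complex_of_real (L2_nrm (op_A \<phi>))
                         + \<i> * (op_B \<phi> x / complex_of_real (L2_nrm (op_B \<phi>)))))\<^sup>2)
    \<and> (L2_nrm (op_A \<phi>))\<^sup>2 =
        (L2_nrm (radial_deriv_H1 \<phi>))\<^sup>2
          - (real CARD('n) - 1) * (real CARD('n) - 3) / 4 * (L2_nrm (op_B \<phi>))\<^sup>2"
proof -
  define n where "n = real CARD('n)"
  \<comment> \<open>The coefficient in A = - \<i> (P + c B).\<close>
  define c where "c = (n - 1) / 2"
  define A where "A = op_A \<phi>"
  define B where "B = op_B \<phi>"
  define P where "P = radial_deriv_H1 \<phi>"
  define w where "w = ip A B"
  define b where "b = L2_nrm B"
  define a where "a = L2_nrm A"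
  have \<phi>L2: "\<phi> \<in> L2" using H1 by (simp add: H1_def)
  have B_L2: "B \<in> L2" using H1_hardy(1)[OF H1 dim] by (simp add: B_def)
  have P_L2: "P \<in> L2" using radial_deriv_H1_L2[OF H1] by (simp add: P_def)
  have B_eq: "(\<lambda>x. inv_norm x * \<phi> x) = B" by (simp add: B_def op_B_def[abs_def])
  have PB: "2 * Re (ip P B) = - (n - 2) * b\<^sup>2"
    using H1_hardy(2)[OF H1 dim] by (simp add: P_def B_def b_def n_def)
  have A_L2: "A \<in> L2"
    using op_A_represented(1)[OF \<phi>L2 _ radial_grad_represented[OF H1]] B_L2 by (simp add: A_def B_eq)
  have c': "(of_nat CARD('n) - 1) / 2 = complex_of_real c" by (simp add: c_def n_def)
  have A_ae: "AE x in lebesgue. A x = - \<i> * P x + (- \<i> * of_real c) * B x"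
    using op_A_represented(2)[OF \<phi>L2 _ radial_grad_represented[OF H1]] B_L2
    unfolding B_eq c' by (simp add: A_def P_def B_def op_B_def)
  have AB_L2: "(\<lambda>x. - \<i> * P x + (- \<i> * of_real c) * B x) \<in> L2"
    by (intro L2_add L2_scale P_L2 B_L2)
  have "w = - \<i> * ip P B + (- \<i> * of_real c) * of_real (b\<^sup>2)"
    unfolding w_def ip_cong_AE[OF A_L2 AB_L2 B_L2 A_ae] ip_linear_left[OF P_L2 B_L2 B_L2] ip_self b_def ..
  then have "Im w = - Re (ip P B) - c * b\<^sup>2" by (simp flip: of_real_power)
  \<comment> \<open>By \<open>PB\<close>, - 2 Im w = 2 Re (P|B) + 2 c b^2 = (- (n - 2) + (n - 1))
    b^2.\<close>
  then have Im_w: "- 2 * Im w = b\<^sup>2" using PB by (simp add: c_def field_simps)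
  \<comment> \<open>The commutator form is cnj w - w = - 2 \<i> Im w.\<close>
  have comm: "- \<i> * commutator_form op_A op_B \<phi> \<phi> = of_real (- 2 * Im w)"
    unfolding commutator_form_def ip_commute[of "op_B \<phi>" "op_A \<phi>"] w_def A_def B_def
    by (simp add: complex_eq_iff)
  have "a\<^sup>2 = (L2_nrm (\<lambda>x. - \<i> * P x + (- \<i> * of_real c) * B x))\<^sup>2"
    unfolding a_def L2_nrm_cong_AE[OF A_L2 AB_L2 A_ae] ..
  also have "\<dots> = (L2_nrm P)\<^sup>2 + c\<^sup>2 * b\<^sup>2 + c * (2 * Re (ip P B))"
    unfolding L2_nrm_combination[OF P_L2 B_L2] b_def by (simp add: norm_mult power_mult_distrib)
  \<comment> \<open>The coefficient of b^2 is c^2 - c (n - 2) = (n - 1)/2 * (3 - n)/2.\<close>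
  also have "\<dots> = (L2_nrm P)\<^sup>2 - (n - 1) * (n - 3) / 4 * b\<^sup>2"
    unfolding PB by (simp add: c_def power2_eq_square field_simps)
  finally have A_nrm: "a\<^sup>2 = (L2_nrm P)\<^sup>2 - (n - 1) * (n - 3) / 4 * b\<^sup>2" .
  have a: "0 < a" unfolding a_def using A_L2 A_nonzero by (intro L2_nrm_pos) (simp_all add: A_def)
  have b: "0 < b" unfolding b_def using B_L2 B_nonzero by (intro L2_nrm_pos) (simp_all add: B_def)
  \<comment> \<open>Both summands are unit vectors, so the square is 2 plus the cross term; the
    factor cnj \<i> = - \<i> turns the real part of w into its imaginary part.\<close>
  have "(L2_nrm (\<lambda>x. A x / of_real a + \<i> * (B x / of_real b)))\<^sup>2 =
      (L2_nrm (\<lambda>x. of_real (1 / a) * A x + (\<i> * of_real (1 / b)) * B x))\<^sup>2" by simp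
  also have "\<dots> = (1 / a)\<^sup>2 * a\<^sup>2 + (1 / b)\<^sup>2 * b\<^sup>2 + 2 * Re (of_real (1 / a) * cnj (\<i> * of_real (1 / b)) * w)"
    unfolding L2_nrm_combination[OF A_L2 B_L2] using a b
    by (simp add: norm_mult norm_divide a_def[symmetric] b_def[symmetric] w_def)
  also have "\<dots> = 2 + 2 * Im w / (a * b)"
    using a b by (simp add: power_divide)
  finally have "a * b * (2 - (L2_nrm (\<lambda>x. A x / of_real a + \<i> * (B x / of_real b)))\<^sup>2) = - 2 * Im w"
    using a b by (simp add: field_simps)
  then have norms: "- 2 * Im w = a * b * (2 - (L2_nrm (\<lambda>x. A x / of_real a + \<i> * (B x / of_real b)))\<^sup>2)"
    by simp
  have formula: "AE x in lebesgue. op_A u x = - \<i> * L2_rep punctured (radial_grad u) x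
      - \<i> * ((of_nat CARD('n) - 1) / 2 * inv_norm x) * u x"
    if "u \<in> dom_A" for u :: "real^'n \<Rightarrow> complex"
  proof -
    from that obtain g where u: "u \<in> L2" "(\<lambda>x. inv_norm x * u x) \<in> L2" "L2_represents punctured (radial_grad u) g"
      by (auto simp: dom_A_def)
    show ?thesis
      using op_A_represented(2)[OF u(1,2) L2_represents_L2_rep[OF u(3)]]
      by eventually_elim (simp add: mult_ac)
  qed
  have dom: "\<phi> \<in> dom_A \<inter> dom_B"
    using \<phi>L2 B_L2 radial_grad_represented[OF H1] by (auto simp: dom_A_def dom_B_def B_eq)
  have "of_real (b\<^sup>2) = - \<i> * commutator_form op_A op_B \<phi> \<phi>"
    unfolding comm Im_w ..
  with comm norms A_nrm show ?thesis
    unfolding A_def[symmetric] B_def[symmetric] P_def[symmetric] a_def[symmetric] b_def[symmetric]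
      w_def[symmetric] n_def[symmetric]
    by (intro conjI ballI formula dom)
qed

end
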